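(* Let $m\ge 5$, let $\vec a=(a_0,a_1,\dots,a_{m-1})\in\mathbb{C}^m$ and $P_m(y)=y^m+a_{m-1}y^{m-1}+\dots+a_1y+a_0$. If the Critical Values Discriminant of $P_m$ satisfies $\mathrm{CVD}(\vec a)\ne 0$, then the multivalued function $P_m^{-1}(x)$, i.e. the solution $y=y(x)$ of $P_m(y)=x$, is not expressed by radicals.
   Context: The companion matrix of a monic polynomial $Q(y)=y^n+c_{n-1}y^{n-1}+\dots+c_0$ is the $n\times n$ matrix with $1$'s on the subdiagonal, last column $(-c_0,-c_1,\dots,-c_{n-1})^T$, and zeros elsewhere; its characteristic polynomial is $Q$ up to sign. Critical Values Discriminant: let $\tilde P_m'(y)=\frac1m P_m'(y)$, let $C(\vec a)$ be the $(m-1)\times(m-1)$ companion matrix of $\tilde P_m'$, let $P_m(C(\vec a))=C(\vec a)^m+a_{m-1}C(\vec a)^{m-1}+\dots+a_1C(\vec a)+a_0I$, and let $U_{m-1}^{\vec a}(y)=\det(P_m(C(\vec a))-yI)$. Then $\mathrm{CVD}(\vec a)$ is the discriminant of $U_{m-1}^{\vec a}$. An algebraic function $y(x)$ is expressed by radicals if it can be obtained from $x$ and complex constants by finitely many rational operations and extractions of roots of integer degree; equivalently, it lies in a field at the top of a finite tower $\mathbb{C}(x)=K_0\subset K_1\subset\dots\subset K_s$ with $K_{i+1}=K_i(r_i)$, $r_i^{n_i}\in K_i$, $n_i\in\mathbb{N}$. *)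

theory Defs
  imports
    "Subresultants.Resultant_Prelim"
    "HOL-Algebra.Generated_Fields"
    "HOL-Algebra.Algebraic_Closure_Type"
begin

section \<open>The Critical Values Discriminant\<close>

text \<open>The parameter vector \<open>(a\<^sub>0, \<dots>, a\<^bsub>m-1\<^esub>)\<close> is a vector of
  dimension \<open>m\<close>, so \<open>m\<close> is recovered as its dimension.\<close>

definition P_poly :: "complex vec \<Rightarrow> complex poly" where
  "P_poly a = Polynomial.monom 1 (dim_vec a) + (\<Sum>i<dim_vec a. Polynomial.monom (a $ i) i)"

definition companion_mat :: "'a :: comm_ring_1 poly \<Rightarrow> 'a mat" where
  "companion_mat Q = (let n = Polynomial.degree Q in
     mat n n (\<lambda>(i, j). if j = n - 1 then - Polynomial.coeff Q i else if i = j + 1 then 1 else 0))"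

text \<open>Square matrices of unspecified dimension do not form a type-class monoid, so the sum
  \<open>\<Sum>\<^sub>k p\<^sub>k A\<^sup>k\<close> is taken entrywise.\<close>

definition poly_mat :: "'a :: comm_ring_1 poly \<Rightarrow> 'a mat \<Rightarrow> 'a mat" where
  "poly_mat p A = mat (dim_row A) (dim_row A)
     (\<lambda>(i, j). \<Sum>k\<le>Polynomial.degree p. Polynomial.coeff p k * (A ^\<^sub>m k) $$ (i, j))"

text \<open>\<open>disc(f) = (-1)\<^bsup>n(n-1)/2\<^esup> c\<^sup>-\<^sup>1 Res(f, f')\<close> for \<open>f\<close> of degree \<open>n\<close> with
  leading coefficient \<open>c\<close>.\<close>

definition discriminant :: "'a :: field poly \<Rightarrow> 'a" where
  "discriminant f = (let n = Polynomial.degree f in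
     (-1) ^ (n * (n - 1) div 2) / Polynomial.coeff f n * resultant f (pderiv f))"

definition C_mat :: "complex vec \<Rightarrow> complex mat" where
  "C_mat a = companion_mat (Polynomial.smult (1 / of_nat (dim_vec a)) (pderiv (P_poly a)))"

text \<open>The determinant \<open>det(P\<^sub>m(C) - y I)\<close> is computed over the polynomial ring, with \<open>y\<close> the
  indeterminate.\<close>

definition U_poly :: "complex vec \<Rightarrow> complex poly" where
  "U_poly a = det (map_mat (\<lambda>c. [:c:]) (poly_mat (P_poly a) (C_mat a))
                     - [:0, 1:] \<cdot>\<^sub>m 1\<^sub>m (dim_vec a - 1))"

definition CVD :: "complex vec \<Rightarrow> complex" where
  "CVD a = discriminant (U_poly a)"


section \<open>Algebraic functions and radicals\<close>

text \<open>Algebraic functions of \<open>x\<close> are the elements of an algebraic closure of \<open>\<complex>(x)\<close>.\<close>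

type_synonym algfun = "complex poly fract alg_closure"

definition fun_const :: "complex \<Rightarrow> algfun" where
  "fun_const c = to_ac (Fraction_Field.Fract [:c:] 1)"

definition fun_x :: algfun where
  "fun_x = to_ac (Fraction_Field.Fract [:0, 1:] 1)"

text \<open>\<open>K 0 \<subseteq> K 1 \<subseteq> \<dots> \<subseteq> K s\<close>, where \<open>K 0 = \<complex>(x)\<close> and \<open>K (i + 1) = K i (r)\<close> with
  \<open>r\<^sup>n \<in> K i\<close>. Requiring \<open>n > 0\<close> is essential, as every \<open>r\<close> satisfies \<open>r\<^sup>0 \<in> K i\<close>.\<close>

definition radical_tower :: "(nat \<Rightarrow> algfun set) \<Rightarrow> nat \<Rightarrow> bool" where
  "radical_tower K s \<longleftrightarrow>
     K 0 = range to_ac \<and>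
     (\<forall>i<s. \<exists>r n. n > 0 \<and> r ^ n \<in> K i \<and>
        K (Suc i) = generate_field ring_of_type_algebra (insert r (K i)))"

definition expressed_by_radicals :: "algfun \<Rightarrow> bool" where
  "expressed_by_radicals y \<longleftrightarrow> (\<exists>K s. radical_tower K s \<and> y \<in> K s)"

end

theory Submission
  imports Defs "Jordan_Normal_Form.Char_Poly"
begin

text \<open>Let \<open>G\<close> be the automorphism group of the algebraic closure of \<open>\<complex>(x)\<close> over \<open>\<complex>(x)\<close>, acting on the
  \<open>m\<close> solutions of \<open>P(y) = x\<close>. The roots of \<open>U\<close> are the critical values of \<open>P\<close>, so
  \<open>CVD \<noteq> 0\<close> means that the critical points are simple with distinct values.

  Near a critical value the solutions are power series in a local parameter, and exactly two of them
  collide; substituting the second one for the first is a symmetry of this configuration, which gives a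
  transposition in \<open>G\<close>. The product of the differences \<open>y - z\<close> over all pairs not exchanged by a
  transposition in \<open>G\<close> is invariant under \<open>G\<close>, hence a rational function of \<open>x\<close>. It has no zeros or
  poles at finite points and, if there is at least one such pair, a pole at infinity. Hence there are none
  and \<open>G\<close> acts as the full symmetric group.

  All roots of unity are constants, so two elements of \<open>G\<close> that fix \<open>K\<^sub>i\<close> have a commutator that fixes
  \<open>K\<^bsub>i+1\<^esub>\<close>. For \<open>m \<ge> 5\<close> each 3-cycle is a commutator of 3-cycles, so every field of the tower is fixed
  by automorphisms acting as arbitrary 3-cycles, and contains no solution.\<close>

hide_const (open) Coset.order Polynomials.degree Polynomials.lead_coeff UnivPoly.coeff UnivPoly.monom
  Module.smult


section \<open>The critical values discriminant\<close>

text \<open>The usual route to the symmetric group is topological: loops around the critical values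
  act by transpositions and together generate a transitive group. Here loops are replaced by
  automorphisms over a field of invariant series, obtained from separability. Generation is replaced
  by the product over unexchanged pairs: solutions that agree at some finite point are exchanged, so
  the remaining factors are units there, while at infinity the solutions have simple poles with
  pairwise different leading coefficients, so each factor keeps its pole. Transitivity comes out as
  a consequence instead of going in as an ingredient. Expansions are organised as embeddings into an
  algebraic closure of the Laurent series. Such an embedding exists for any nonconstant expansion of
  x, before anything is known about the solutions; that these are series follows by counting series
  solutions against the degree. Setting x = P(c + t), rather than adjoining a fractional power of x
  - v, keeps all exponents integral and makes c + t itself a solution.\<close>

lemma companion_mat_carrier: "companion_mat Q \<in> carrier_mat (degree Q) (degree Q)"
  by (simp add: companion_mat_def Let_def)

lemma monom_sum: "Polynomial.monom (\<Sum>x\<in>A. f x) i = (\<Sum>x\<in>A. Polynomial.monom (f x) i)"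
  by (induction A rule: infinite_finite_induct) (simp_all add: add_monom[symmetric])

text \<open>The companion matrix is multiplication by y on polynomials modulo Q in the monomial
  basis. Only the last column involves a reduction, of y^n to minus the lower part of Q; for the
  other columns the difference is zero.\<close>

lemma companion_mat_dvd:
  fixes Q :: "'a::comm_ring_1 poly"
  assumes Q: "lead_coeff Q = 1" and j: "j < degree Q"
  shows "Q dvd Polynomial.monom 1 (Suc j) - (\<Sum>i<degree Q. Polynomial.monom (companion_mat Q $$ (i, j)) i)"
proof (cases "j = degree Q - 1")
  case True
  then have "Suc j = degree Q" using j by simp
  have "(\<Sum>i<degree Q. Polynomial.monom (companion_mat Q $$ (i, j)) i) = - (\<Sum>i<degree Q. Polynomial.monom (coeff Q i) i)"
    unfolding sum_negf[symmetric]
    by (rule sum.cong) (use j True in \<open>simp_all add: companion_mat_def Let_def minus_monom\<close>)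
  moreover have "Q = (\<Sum>i<degree Q. Polynomial.monom (coeff Q i) i) + Polynomial.monom 1 (degree Q)"
    using poly_as_sum_of_monoms[of Q] Q by (simp add: lessThan_Suc_atMost[symmetric])
  ultimately have "Polynomial.monom 1 (Suc j) - (\<Sum>i<degree Q. Polynomial.monom (companion_mat Q $$ (i, j)) i) = Q"
    using \<open>Suc j = degree Q\<close> by (simp add: add.commute)
  then show ?thesis by simp
next
  case False
  then have "Suc j < degree Q" using j by simp
  have "(\<Sum>i<degree Q. Polynomial.monom (companion_mat Q $$ (i, j)) i) =
      (\<Sum>i<degree Q. if i = Suc j then Polynomial.monom 1 (Suc j) else 0)"
    by (rule sum.cong) (use j False in \<open>auto simp: companion_mat_def Let_def\<close>)
  also have "\<dots> = Polynomial.monom 1 (Suc j)" using \<open>Suc j < degree Q\<close> by simp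
  finally show ?thesis by simp
qed

text \<open>Column j of C first rewrites y^k * y^(j+1) in terms of the y^(k+l), and the induction
  hypothesis reduces each of these; hence the induction is over all columns at once.\<close>

lemma companion_mat_power_dvd:
  fixes Q :: "'a::comm_ring_1 poly"
  assumes Q: "lead_coeff Q = 1" and j: "j < degree Q"
  shows "Q dvd Polynomial.monom 1 (k + j) - (\<Sum>i<degree Q. Polynomial.monom ((companion_mat Q ^\<^sub>m k) $$ (i, j)) i)"
  using j
proof (induction k arbitrary: j)
  case 0
  have "dim_row (companion_mat Q) = degree Q" by (simp add: companion_mat_def Let_def)
  then have "(\<Sum>i<degree Q. Polynomial.monom ((companion_mat Q ^\<^sub>m 0) $$ (i, j)) i) =
      (\<Sum>i<degree Q. if i = j then Polynomial.monom 1 j else 0)"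
    by (intro sum.cong) (use 0 in auto)
  also have "\<dots> = Polynomial.monom 1 j" using 0 by simp
  finally show ?case by simp
next
  case (Suc k)
  let ?n = "degree Q" and ?C = "companion_mat Q"
  let ?X = "?C ^\<^sub>m k"
  have C: "?C \<in> carrier_mat ?n ?n" by (rule companion_mat_carrier)
  then have X: "?X \<in> carrier_mat ?n ?n" by (rule pow_carrier_mat)
  have entry: "(?C ^\<^sub>m Suc k) $$ (i, j) = (\<Sum>l<?n. ?X $$ (i, l) * ?C $$ (l, j))" if "i < ?n" for i
    using C X that Suc.prems by (simp add: scalar_prod_def atLeast0LessThan)
  have "(\<Sum>i<?n. Polynomial.monom ((?C ^\<^sub>m Suc k) $$ (i, j)) i) =
      (\<Sum>i<?n. \<Sum>l<?n. Polynomial.smult (?C $$ (l, j)) (Polynomial.monom (?X $$ (i, l)) i))"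
    by (intro sum.cong refl) (simp only: lessThan_iff entry monom_sum, simp add: smult_monom mult.commute)
  also have "\<dots> = (\<Sum>l<?n. Polynomial.smult (?C $$ (l, j)) (\<Sum>i<?n. Polynomial.monom (?X $$ (i, l)) i))"
    by (subst sum.swap) (simp add: smult_sum2)
  finally have eq: "Polynomial.monom 1 (Suc k + j) - (\<Sum>i<?n. Polynomial.monom ((?C ^\<^sub>m Suc k) $$ (i, j)) i) =
      Polynomial.monom 1 k * (Polynomial.monom 1 (Suc j) - (\<Sum>l<?n. Polynomial.monom (?C $$ (l, j)) l)) +
      (\<Sum>l<?n. Polynomial.smult (?C $$ (l, j)) (Polynomial.monom 1 (k + l) - (\<Sum>i<?n. Polynomial.monom (?X $$ (i, l)) i)))"
    by (simp add: smult_diff_right sum_subtractf right_diff_distrib sum_distrib_left mult_monom smult_monom)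
  show ?case unfolding eq
    by (intro dvd_add dvd_mult dvd_sum dvd_smult companion_mat_dvd[OF Q Suc.prems] Suc.IH) simp
qed

text \<open>Column \<open>j\<close> of \<open>p(C)\<close> holds the coordinates of \<open>p(y) y\<^sup>j\<close> modulo \<open>Q\<close>.\<close>

lemma poly_mat_companion_dvd:
  fixes Q :: "'a::comm_ring_1 poly"
  assumes Q: "lead_coeff Q = 1" and j: "j < degree Q"
  shows "Q dvd p * Polynomial.monom 1 j - (\<Sum>i<degree Q. Polynomial.monom (poly_mat p (companion_mat Q) $$ (i, j)) i)"
proof -
  let ?n = "degree Q" and ?C = "companion_mat Q"
  have dim: "dim_row ?C = ?n" by (simp add: companion_mat_def Let_def)
  have "(\<Sum>i<?n. Polynomial.monom (poly_mat p ?C $$ (i, j)) i) =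
      (\<Sum>i<?n. \<Sum>k\<le>degree p. Polynomial.smult (coeff p k) (Polynomial.monom ((?C ^\<^sub>m k) $$ (i, j)) i))"
    by (intro sum.cong refl) (use j in \<open>simp add: poly_mat_def dim monom_sum smult_monom\<close>)
  also have "\<dots> = (\<Sum>k\<le>degree p. Polynomial.smult (coeff p k) (\<Sum>i<?n. Polynomial.monom ((?C ^\<^sub>m k) $$ (i, j)) i))"
    by (subst sum.swap) (simp add: smult_sum2)
  moreover have "p * Polynomial.monom 1 j = (\<Sum>k\<le>degree p. Polynomial.smult (coeff p k) (Polynomial.monom 1 (k + j)))"
    by (subst poly_as_sum_of_monoms[symmetric]) (simp add: sum_distrib_right mult_monom smult_monom)
  ultimately have eq: "p * Polynomial.monom 1 j - (\<Sum>i<?n. Polynomial.monom (poly_mat p ?C $$ (i, j)) i) =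
      (\<Sum>k\<le>degree p. Polynomial.smult (coeff p k) (Polynomial.monom 1 (k + j) - (\<Sum>i<?n. Polynomial.monom ((?C ^\<^sub>m k) $$ (i, j)) i)))"
    by (simp add: smult_diff_right sum_subtractf)
  show ?thesis unfolding eq
    by (intro dvd_sum dvd_smult companion_mat_power_dvd[OF Q j])
qed

section \<open>Eigenvectors and double roots of the characteristic polynomial\<close>

lemma left_eigenvector_root:
  fixes A :: "complex mat"
  assumes A: "A \<in> carrier_mat n n" and u: "\<And>j. j < n \<Longrightarrow> (\<Sum>i<n. A $$ (i, j) * u i) = \<mu> * u j"
    and p: "p < n" "u p \<noteq> 0"
  shows "poly (char_poly A) \<mu> = 0"
proof -
  have "eigenvector (transpose_mat A) (vec n u) \<mu>"
    unfolding eigenvector_def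
  proof (intro conjI)
    show "vec n u \<in> carrier_vec (dim_row (transpose_mat A))" using A by simp
    show "vec n u \<noteq> 0\<^sub>v (dim_row (transpose_mat A))"
    proof
      assume "vec n u = 0\<^sub>v (dim_row (transpose_mat A))"
      then have "vec n u $ p = 0\<^sub>v n $ p" using A by simp
      then show False using p by simp
    qed
    show "transpose_mat A *\<^sub>v vec n u = \<mu> \<cdot>\<^sub>v vec n u"
      by (rule eq_vecI) (use A u in \<open>simp_all add: scalar_prod_def atLeast0LessThan\<close>)
  qed
  then have "eigenvalue (transpose_mat A) \<mu>" by (auto simp: eigenvalue_def)
  then have "poly (char_poly (transpose_mat A)) \<mu> = 0"
    using eigenvalue_root_char_poly[of "transpose_mat A" n] A by simp
  then show ?thesis using A by simp
qed

text \<open>The derivative of the characteristic polynomial is the sum of those of the principal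
  submatrices, and the span of \<open>u\<close> and \<open>v\<close> contains a nonzero vector whose \<open>i\<close>-th entry vanishes.\<close>

lemma two_left_eigenvectors:
  fixes A :: "complex mat"
  assumes A: "A \<in> carrier_mat n n"
    and u: "\<And>j. j < n \<Longrightarrow> (\<Sum>i<n. A $$ (i, j) * u i) = \<mu> * u j"
    and v: "\<And>j. j < n \<Longrightarrow> (\<Sum>i<n. A $$ (i, j) * v i) = \<mu> * v j"
    and pq: "p < n" "q < n" "u p * v q \<noteq> u q * v p"
  shows "poly (char_poly A) \<mu> = 0" "poly (pderiv (char_poly A)) \<mu> = 0"
proof -
  have u_nz: "u p \<noteq> 0 \<or> u q \<noteq> 0" using pq by auto
  then show "poly (char_poly A) \<mu> = 0" using left_eigenvector_root[OF A u] pq by blast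
  have "poly (char_poly (mat_delete A i i)) \<mu> = 0" if i: "i < n" for i
  proof -
    obtain w where w: "\<And>j. j < n \<Longrightarrow> (\<Sum>k<n. A $$ (k, j) * w k) = \<mu> * w j" "w i = 0" "w p \<noteq> 0 \<or> w q \<noteq> 0"
    proof (cases "u i = 0 \<and> v i = 0")
      case True
      then show ?thesis using that[of u] u u_nz by blast
    next
      case False
      define w where "w = (\<lambda>k. v i * u k - u i * v k)"
      show ?thesis
      proof (rule that[of w])
        fix j assume j: "j < n"
        have "(\<Sum>k<n. A $$ (k, j) * w k) = v i * (\<Sum>k<n. A $$ (k, j) * u k) - u i * (\<Sum>k<n. A $$ (k, j) * v k)"
          unfolding w_def sum_distrib_left sum_subtractf[symmetric]
          by (intro sum.cong refl) (simp add: algebra_simps)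
        then show "(\<Sum>k<n. A $$ (k, j) * w k) = \<mu> * w j" using u[OF j] v[OF j] by (simp add: w_def algebra_simps)
      next
        show "w i = 0" by (simp add: w_def)
        \<comment> \<open>The minors of \<open>w\<close> against \<open>v\<close> and against
          \<open>u\<close> are \<open>v i\<close> and \<open>u i\<close> times the nonzero minor of
          \<open>u\<close> and \<open>v\<close>, so \<open>w\<close> cannot vanish at both
          \<open>p\<close> and \<open>q\<close>.\<close>
        have "w p * v q - w q * v p = v i * (u p * v q - u q * v p)"
          "w p * u q - w q * u p = u i * (u p * v q - u q * v p)"
          by (simp_all add: w_def algebra_simps)
        then show "w p \<noteq> 0 \<or> w q \<noteq> 0" using False pq(3) by auto
      qed
    qed
    then obtain r where r: "r < n" "w r \<noteq> 0" using pq by blast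
    then have "r \<noteq> i" using w(2) by auto
    have img: "insert_index i ` {..<n - 1} = {..<n} - {i}"
      using insert_index_image[of i "n - 1"] i by (simp add: atLeast0LessThan)
    have inj: "inj_on (insert_index i) {..<n - 1}" by (rule insert_index_inj_on)
    have B: "mat_delete A i i \<in> carrier_mat (n - 1) (n - 1)" by (rule mat_delete_carrier[OF A])
    have "r \<in> insert_index i ` {..<n - 1}" unfolding img using r \<open>r \<noteq> i\<close> by simp
    then obtain r' where r': "r' < n - 1" "insert_index i r' = r" by auto
    \<comment> \<open>Since \<open>w i = 0\<close>, deleting row \<open>i\<close> drops only a zero
      term from each sum, so the restriction of \<open>w\<close> is a left eigenvector of the
      principal submatrix.\<close>
    show ?thesis
    proof (rule left_eigenvector_root[OF B, where u = "\<lambda>k. w (insert_index i k)"])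
      fix j assume j: "j < n - 1"
      have ins: "insert_index i j < n" using j by (auto simp: insert_index_def)
      have idx: "mat_delete A i i $$ (k, j) = A $$ (insert_index i k, insert_index i j)" if "k < n - 1" for k
        using i j that A by (auto simp: mat_delete_def insert_index_def)
      have "(\<Sum>k<n - 1. mat_delete A i i $$ (k, j) * w (insert_index i k)) =
          (\<Sum>k<n - 1. A $$ (insert_index i k, insert_index i j) * w (insert_index i k))"
        by (intro sum.cong refl) (simp add: idx)
      also have "\<dots> = (\<Sum>k\<in>{..<n} - {i}. A $$ (k, insert_index i j) * w k)"
        unfolding img[symmetric] by (subst sum.reindex[OF inj]) simp
      also have "\<dots> = (\<Sum>k<n. A $$ (k, insert_index i j) * w k)"
        using w(2) i by (simp add: sum.remove[of "{..<n}" i])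
      also have "\<dots> = \<mu> * w (insert_index i j)" by (rule w(1)[OF ins])
      finally show "(\<Sum>k<n - 1. mat_delete A i i $$ (k, j) * w (insert_index i k)) = \<mu> * w (insert_index i j)" .
    qed (use r' r in auto)
  qed
  then show "poly (pderiv (char_poly A)) \<mu> = 0"
    by (simp add: pderiv_char_poly[OF A] poly_sum)
qed

text \<open>Each row of the Sylvester matrix lists the coefficients of a monomial multiple of f or
  g, in descending order. Pairing it with the descending powers of \<mu> evaluates that multiple at
  \<mu>, so these powers form a kernel vector; it is nonzero because its last entry is \<mu>^0 =
  1.\<close>

lemma resultant_common_root:
  fixes f g :: "'a::field poly"
  assumes "poly f \<mu> = 0" "poly g \<mu> = 0" "degree f > 0"
  shows "resultant f g = 0"
proof -
  define N where "N = degree f + degree g"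
  have S: "sylvester_mat f g \<in> carrier_mat N N" unfolding N_def by (rule sylvester_carrier_mat)
  define w where "w = vec N (\<lambda>j. \<mu> ^ (N - 1 - j))"
  have "N > 0" using assms(3) by (simp add: N_def)
  have "w \<noteq> 0\<^sub>v N"
  proof
    assume "w = 0\<^sub>v N"
    then have "w $ (N - 1) = 0" using \<open>N > 0\<close> by simp
    then show False using \<open>N > 0\<close> by (simp add: w_def)
  qed
  moreover have "sylvester_mat f g *\<^sub>v w = 0\<^sub>v N"
  proof (rule eq_vecI)
    show "dim_vec (sylvester_mat f g *\<^sub>v w) = dim_vec (0\<^sub>v N)" by (simp add: N_def)
    fix i assume "i < dim_vec (0\<^sub>v N :: 'a vec)"
    then have i: "i < N" by simp
    define h where "h = (if i < degree g then Polynomial.monom 1 (degree g - 1 - i) * f else Polynomial.monom 1 (N - 1 - i) * g)"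
    have entry: "sylvester_mat f g $$ (i, j) = coeff h (N - 1 - j)" if "j < N" for j
      using sylvester_index_mat2[of i f g j] i that
      by (auto simp: N_def h_def coeff_monom_mult intro!: arg_cong[of _ _ "coeff _"])
    have "degree h < N"
    proof -
      have "degree (Polynomial.monom (1::'a) k * q) \<le> k + degree q" for k and q :: "'a poly"
        by (rule order.trans[OF degree_mult_le]) (simp add: degree_monom_le)
      note this[of "degree g - 1 - i" f] this[of "N - 1 - i" g]
      then show ?thesis using i unfolding h_def N_def by (auto split: if_splits)
    qed
    have "(sylvester_mat f g *\<^sub>v w) $ i = (\<Sum>j<N. coeff h (N - 1 - j) * \<mu> ^ (N - 1 - j))"
    proof -
      have "(sylvester_mat f g *\<^sub>v w) $ i = row (sylvester_mat f g) i \<bullet> w" using i by (intro index_mult_mat_vec) (simp add: N_def)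
      also have "\<dots> = (\<Sum>j<N. sylvester_mat f g $$ (i, j) * w $ j)"
        unfolding scalar_prod_def using i by (intro sum.cong) (auto simp: w_def N_def)
      also have "\<dots> = (\<Sum>j<N. coeff h (N - 1 - j) * \<mu> ^ (N - 1 - j))"
        by (intro sum.cong refl) (simp add: entry w_def)
      finally show ?thesis .
    qed
    also have "\<dots> = (\<Sum>l<N. coeff h l * \<mu> ^ l)"
      using sum.nat_diff_reindex[of "\<lambda>l. coeff h l * \<mu> ^ l" N] by simp
    also have "\<dots> = poly h \<mu>"
      unfolding poly_altdef using \<open>degree h < N\<close>
      by (intro sum.mono_neutral_right) (auto simp: coeff_eq_0)
    also have "\<dots> = 0" using assms by (simp add: h_def)
    finally show "(sylvester_mat f g *\<^sub>v w) $ i = 0\<^sub>v N $ i" using i by simp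
  qed
  moreover have "w \<in> carrier_vec N" by (simp add: w_def)
  ultimately show ?thesis
    unfolding resultant_def using det_0_iff_vec_prod_zero_field[OF S] by blast
qed

lemma det_minus_indeterminate:
  fixes A :: "'a::comm_ring_1 mat"
  assumes A: "A \<in> carrier_mat n n"
  shows "det (map_mat (\<lambda>c. [:c:]) A - [:0, 1:] \<cdot>\<^sub>m 1\<^sub>m n) = (-1) ^ n * char_poly A"
proof -
  have "map_mat (\<lambda>c. [:c:]) A - [:0, 1:] \<cdot>\<^sub>m 1\<^sub>m n = (-1) \<cdot>\<^sub>m char_poly_matrix A"
    by (rule eq_matI) (use A in \<open>auto simp: char_poly_matrix_def\<close>)
  moreover have "dim_col (char_poly_matrix A) = n" using char_poly_matrix_closed[OF A] by (rule carrier_matD)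
  ultimately show ?thesis by (simp add: char_poly_def)
qed

lemma degree_P_poly: "degree (P_poly a) = dim_vec a" "lead_coeff (P_poly a) = 1"
proof -
  have c: "coeff (P_poly a) i = (if i = dim_vec a then 1 else if i < dim_vec a then a $ i else 0)" for i
  proof -
    have "coeff (\<Sum>i<dim_vec a. Polynomial.monom (a $ i) i) i = (\<Sum>k<dim_vec a. if i = k then a $ k else 0)"
      unfolding coeff_sum by (intro sum.cong) (auto simp: coeff_monom)
    also have "\<dots> = (if i < dim_vec a then a $ i else 0)" by (subst sum.delta') simp_all
    finally show ?thesis by (simp add: P_poly_def coeff_monom)
  qed
  show 1: "degree (P_poly a) = dim_vec a"
  proof (rule antisym)
    show "degree (P_poly a) \<le> dim_vec a" by (rule degree_le) (simp add: c)
    show "dim_vec a \<le> degree (P_poly a)" by (rule le_degree) (simp add: c)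
  qed
  show "lead_coeff (P_poly a) = 1" by (simp add: 1 c)
qed

text \<open>By the congruences modulo \<open>Q\<close>, \<open>(c\<^sup>i)\<^sub>i\<close> is a left eigenvector of \<open>P(C)\<close> with eigenvalue \<open>P(c)\<close>
  for each critical point \<open>c\<close>, and so is the derivative \<open>(i c\<^bsup>i-1\<^esup>)\<^sub>i\<close> if \<open>c\<close> is degenerate. A
  degenerate critical point or a repeated critical value thus makes \<open>U\<close> have a double root.\<close>

lemma CVD_nonzero_critical:
  assumes m: "dim_vec a \<ge> 3" and cvd: "CVD a \<noteq> 0"
  shows "poly (pderiv (P_poly a)) c = 0 \<Longrightarrow> poly (pderiv (pderiv (P_poly a))) c \<noteq> 0"
    and "poly (pderiv (P_poly a)) c = 0 \<Longrightarrow> poly (pderiv (P_poly a)) d = 0 \<Longrightarrow>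
      poly (P_poly a) c = poly (P_poly a) d \<Longrightarrow> c = d"
proof -
  define P where "P = P_poly a"
  define m where "m = dim_vec a"
  define Q where "Q = Polynomial.smult (1 / of_nat m) (pderiv P)"
  define A where "A = poly_mat P (companion_mat Q)"
  have m3: "m \<ge> 3" using m by (simp add: m_def)
  have Q: "degree Q = m - 1" "lead_coeff Q = 1"
  proof -
    show 1: "degree Q = m - 1" using m3 by (simp add: Q_def P_def degree_pderiv degree_P_poly m_def)
    have "coeff P m = 1" using degree_P_poly[of a] by (simp add: P_def m_def)
    then show "lead_coeff Q = 1" using m3 unfolding 1 by (simp add: Q_def coeff_pderiv)
  qed
  have A: "A \<in> carrier_mat (m - 1) (m - 1)"
    using Q by (simp add: A_def poly_mat_def companion_mat_def Let_def)
  have U: "U_poly a = (-1) ^ (m - 1) * char_poly A"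
    unfolding U_poly_def C_mat_def using det_minus_indeterminate[OF A] by (simp add: A_def P_def Q_def m_def)
  have degU: "degree (U_poly a) = m - 1"
  proof -
    have "degree (char_poly A) = m - 1" using degree_monic_char_poly[OF A] by simp
    then show ?thesis unfolding U by (cases "even (m - 1)") simp_all
  qed
  have no_double: False if "poly (char_poly A) \<mu> = 0" "poly (pderiv (char_poly A)) \<mu> = 0" for \<mu>
  proof -
    have "poly (U_poly a) \<mu> = 0" using that unfolding U by simp
    moreover have "poly (pderiv (U_poly a)) \<mu> = 0"
      using that unfolding U by (cases "even (m - 1)") (simp_all add: pderiv_minus)
    ultimately have "resultant (U_poly a) (pderiv (U_poly a)) = 0"
      using degU m3 by (intro resultant_common_root) auto
    then show False using cvd by (simp add: CVD_def discriminant_def Let_def)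
  qed
  have dvd: "Q dvd P * Polynomial.monom 1 j - (\<Sum>i<m - 1. Polynomial.monom (A $$ (i, j)) i)" if "j < m - 1" for j
    using poly_mat_companion_dvd[OF Q(2), of j P] that by (simp add: A_def Q(1))
  have Qroot: "poly Q c = 0" if "poly (pderiv P) c = 0" for c using that by (simp add: Q_def)
  have eig: "(\<Sum>i<m - 1. A $$ (i, j) * c ^ i) = poly P c * c ^ j" if c: "poly (pderiv P) c = 0" and j: "j < m - 1" for c j
  proof -
    obtain R where "P * Polynomial.monom 1 j - (\<Sum>i<m - 1. Polynomial.monom (A $$ (i, j)) i) = Q * R" using dvd[OF j] by (elim dvdE)
    then have "poly (P * Polynomial.monom 1 j - (\<Sum>i<m - 1. Polynomial.monom (A $$ (i, j)) i)) c = 0"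
      using Qroot[OF c] by simp
    then show ?thesis by (simp add: poly_sum poly_monom)
  qed
  \<comment> \<open>For exponent 0 the truncated \<open>i - 1\<close> is harmless, because the
    factor \<open>of_nat 0\<close> removes the term.\<close>
  have eig': "(\<Sum>i<m - 1. A $$ (i, j) * (of_nat i * c ^ (i - 1))) = poly P c * (of_nat j * c ^ (j - 1))"
    if c: "poly (pderiv P) c = 0" "poly (pderiv (pderiv P)) c = 0" and j: "j < m - 1" for c j
  proof -
    obtain R where R: "P * Polynomial.monom 1 j - (\<Sum>i<m - 1. Polynomial.monom (A $$ (i, j)) i) = Q * R" using dvd[OF j] by (elim dvdE)
    have "poly (pderiv Q) c = 0" using c(2) by (simp add: Q_def pderiv_smult)
    then have "poly (pderiv (Q * R)) c = 0" using Qroot[OF c(1)] by (simp add: pderiv_mult)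
    then have "poly (pderiv (P * Polynomial.monom 1 j)) c = poly (pderiv (\<Sum>i<m - 1. Polynomial.monom (A $$ (i, j)) i)) c"
      unfolding R[symmetric] by (simp add: pderiv_diff)
    moreover have "poly (pderiv (P * Polynomial.monom 1 j)) c = poly P c * (of_nat j * c ^ (j - 1))"
      using c(1) by (simp add: pderiv_mult pderiv_monom poly_monom)
    moreover have "poly (pderiv (\<Sum>i<m - 1. Polynomial.monom (A $$ (i, j)) i)) c = (\<Sum>i<m - 1. A $$ (i, j) * (of_nat i * c ^ (i - 1)))"
      by (simp add: pderiv_sum poly_sum pderiv_monom poly_monom mult_ac)
    ultimately show ?thesis by simp
  qed
  have "poly (pderiv (pderiv P)) c \<noteq> 0" if c: "poly (pderiv P) c = 0"
  proof
    assume c2: "poly (pderiv (pderiv P)) c = 0"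
    \<comment> \<open>Entries 0 and 1 of the two vectors are (1, c) and (0, 1), with minor 1; both
      indices are in range because m is at least 3.\<close>
    show False
      by (rule no_double[of "poly P c"];
        rule two_left_eigenvectors[OF A eig[OF c] eig'[OF c c2], of 0 1]) (use m3 in auto)
  qed
  then show "poly (pderiv (P_poly a)) c = 0 \<Longrightarrow> poly (pderiv (pderiv (P_poly a))) c \<noteq> 0"
    by (simp add: P_def)
  have "c = d" if cd: "poly (pderiv P) c = 0" "poly (pderiv P) d = 0" "poly P c = poly P d"
  proof (rule ccontr)
    assume "c \<noteq> d"
    \<comment> \<open>Here entries 0 and 1 are (1, c) and (1, d), with minor d - c.\<close>
    show False
      by (rule no_double[of "poly P d"];
        rule two_left_eigenvectors[OF A eig[OF cd(1), unfolded cd(3)] eig[OF cd(2)], of 0 1]) (use m3 \<open>c \<noteq> d\<close> in auto)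
  qed
  then show "poly (pderiv (P_poly a)) c = 0 \<Longrightarrow> poly (pderiv (P_poly a)) d = 0 \<Longrightarrow>
      poly (P_poly a) c = poly (P_poly a) d \<Longrightarrow> c = d"
    by (simp add: P_def)
qed

section \<open>Extending homomorphisms to an algebraic closure\<close>

text \<open>Closure under inverses follows from \<open>subring_set_inverse\<close> as soon as the
  base field is contained, so these sets serve as intermediate fields.\<close>

definition subring_set :: "'a::comm_ring_1 set \<Rightarrow> bool" where
  "subring_set K \<longleftrightarrow> 1 \<in> K \<and> (\<forall>x\<in>K. \<forall>y\<in>K. x - y \<in> K \<and> x * y \<in> K)"

lemma subring_setD:
  assumes "subring_set K"
  shows "1 \<in> K" "0 \<in> K" "x \<in> K \<Longrightarrow> y \<in> K \<Longrightarrow> x - y \<in> K" "x \<in> K \<Longrightarrow> - x \<in> K"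
    "x \<in> K \<Longrightarrow> y \<in> K \<Longrightarrow> x + y \<in> K" "x \<in> K \<Longrightarrow> y \<in> K \<Longrightarrow> x * y \<in> K" "of_nat n \<in> K"
proof -
  show 1: "1 \<in> K" and d: "\<And>x y. x \<in> K \<Longrightarrow> y \<in> K \<Longrightarrow> x - y \<in> K" and "x \<in> K \<Longrightarrow> y \<in> K \<Longrightarrow> x * y \<in> K"
    for x y using assms by (auto simp: subring_set_def)
  show 0: "0 \<in> K" using d[OF 1 1] by simp
  show m: "- x \<in> K" if "x \<in> K" for x using d[OF 0 that] by simp
  show p: "x + y \<in> K" if "x \<in> K" "y \<in> K" for x y using d[OF that(1) m[OF that(2)]] by simp
  show "of_nat n \<in> K" by (induction n) (auto simp: 0 1 p)
qed

lemma subring_set_poly: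
  assumes "subring_set K" "\<And>i. coeff p i \<in> K" "x \<in> K"
  shows "poly p x \<in> K"
  using assms(2)
proof (induction p)
  case (pCons a p)
  have "coeff p i \<in> K" for i using pCons.prems[of "Suc i"] by simp
  moreover have "a \<in> K" using pCons.prems[of 0] by simp
  ultimately show ?case using pCons.IH assms by (auto intro!: subring_setD)
qed (use assms in \<open>auto intro!: subring_setD\<close>)

text \<open>In an algebraic relation for x over the base field, powers of x are cancelled until the
  constant term c is nonzero; then c + x q(x) = 0 exhibits the inverse as - q(x) / c.\<close>

lemma subring_set_inverse:
  fixes x :: "'a::field alg_closure"
  assumes K: "subring_set K" "range to_ac \<subseteq> K" and x: "x \<in> K"
  shows "inverse x \<in> K"
proof (cases "x = 0")
  case False
  obtain p :: "'a poly" where "p \<noteq> 0" "poly (map_poly to_ac p) x = 0"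
    by (rule alg_closure_algebraic)
  then show ?thesis
  proof (induction p)
    case (pCons c q)
    have c: "to_ac c + x * poly (map_poly to_ac q) x = 0"
      using pCons.prems by (auto simp: map_poly_pCons)
    show ?case
    proof (cases "c = 0")
      case True
      then show ?thesis using pCons c False by auto
    next
      case nz: False
      have "inverse x * to_ac c = - poly (map_poly to_ac q) x"
        using c False by (simp add: field_simps eq_neg_iff_add_eq_0)
      then have "inverse x = - poly (map_poly to_ac q) x * to_ac (inverse c)"
        using nz by (simp add: field_simps)
      moreover have "poly (map_poly to_ac q) x \<in> K"
        using K x by (intro subring_set_poly) (auto simp: coeff_map_poly)
      moreover have "to_ac (inverse c) \<in> K" using K(2) by blast
      ultimately show ?thesis using subring_setD(4,6)[OF K(1)] by metis
    qed
  qed auto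
qed (use K in \<open>auto intro: subring_setD\<close>)

text \<open>A ring homomorphism defined on a subring of \<open>'a\<close> is represented by its graph.\<close>

definition hom_graph :: "('a::comm_ring_1 \<times> 'b::comm_ring_1) set \<Rightarrow> bool" where
  "hom_graph R \<longleftrightarrow> (1, 1) \<in> R \<and>
     (\<forall>a b c d. (a, b) \<in> R \<longrightarrow> (c, d) \<in> R \<longrightarrow> (a - c, b - d) \<in> R \<and> (a * c, b * d) \<in> R) \<and>
     (\<forall>b. (0, b) \<in> R \<longrightarrow> b = 0)"

lemma hom_graphD:
  assumes "hom_graph R"
  shows "(1, 1) \<in> R" "(0, 0) \<in> R"
    "(a, b) \<in> R \<Longrightarrow> (c, d) \<in> R \<Longrightarrow> (a - c, b - d) \<in> R"
    "(a, b) \<in> R \<Longrightarrow> (c, d) \<in> R \<Longrightarrow> (a + c, b + d) \<in> R"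
    "(a, b) \<in> R \<Longrightarrow> (c, d) \<in> R \<Longrightarrow> (a * c, b * d) \<in> R"
    "(0, b) \<in> R \<Longrightarrow> b = 0"
    "(a, b) \<in> R \<Longrightarrow> (a, b') \<in> R \<Longrightarrow> b = b'"
proof -
  show 1: "(1, 1) \<in> R" and d: "\<And>a b c d. (a, b) \<in> R \<Longrightarrow> (c, d) \<in> R \<Longrightarrow> (a - c, b - d) \<in> R"
    and "\<And>a b c d. (a, b) \<in> R \<Longrightarrow> (c, d) \<in> R \<Longrightarrow> (a * c, b * d) \<in> R"
    and z: "\<And>b. (0, b) \<in> R \<Longrightarrow> b = 0"
    using assms by (auto simp: hom_graph_def)
  show 0: "(0, 0) \<in> R" using d[OF 1 1] by simp
  show "(a + c, b + d) \<in> R" if "(a, b) \<in> R" "(c, d) \<in> R" for a b c d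
    using d[OF that(1) d[OF 0 that(2)]] by simp
  show "b = b'" if "(a, b) \<in> R" "(a, b') \<in> R"
    using z[of "b - b'"] d[OF that] by simp
qed

lemma hom_graph_sum:
  assumes "hom_graph R" "\<And>i. i \<in> I \<Longrightarrow> (f i, g i) \<in> R"
  shows "(sum f I, sum g I) \<in> R"
  using assms(2) by (induction I rule: infinite_finite_induct) (auto intro: hom_graphD[OF assms(1)])

lemma hom_graph_Domain: "hom_graph R \<Longrightarrow> subring_set (Domain R)"
  unfolding subring_set_def by (auto intro: hom_graphD(1,3,5))

text \<open>The domain contains the inverse of \<open>a\<close> by
  \<open>subring_set_inverse\<close>, and the image of that inverse is an inverse of
  \<open>b\<close>.\<close>

lemma hom_graph_nonzero:
  fixes R :: "('a::field alg_closure \<times> 'b::field) set"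
  assumes R: "hom_graph R" "range to_ac \<subseteq> Domain R" and ab: "(a, b) \<in> R" "a \<noteq> 0"
  shows "b \<noteq> 0"
proof -
  have "inverse a \<in> Domain R"
    using assms by (intro subring_set_inverse hom_graph_Domain) auto
  then obtain c where "(inverse a, c) \<in> R" by blast
  then have "(1, b * c) \<in> R" using hom_graphD(5)[OF R(1) ab(1)] ab by fastforce
  then have "b * c = 1" using hom_graphD(1,7)[OF R(1)] by blast
  then show ?thesis by auto
qed

definition poly_graph :: "('a::comm_ring_1 \<times> 'b::comm_ring_1) set \<Rightarrow> 'a poly \<Rightarrow> 'b poly \<Rightarrow> bool" where
  "poly_graph R p q \<longleftrightarrow> (\<forall>i. (coeff p i, coeff q i) \<in> R)"

text \<open>A minimal polynomial of \<open>x\<close> over the domain of \<open>R\<close>, not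
  normalised to be monic. Its image \<open>p'\<close> is carried along because a graph gives no
  function to apply to the coefficients.\<close>

definition minimal_poly_graph ::
    "('a::comm_ring_1 \<times> 'b::comm_ring_1) set \<Rightarrow> 'a \<Rightarrow> 'a poly \<Rightarrow> 'b poly \<Rightarrow> bool" where
  "minimal_poly_graph R x p p' \<longleftrightarrow> poly_graph R p p' \<and> p \<noteq> 0 \<and> poly p x = 0 \<and>
     (\<forall>q q'. poly_graph R q q' \<longrightarrow> q \<noteq> 0 \<longrightarrow> poly q x = 0 \<longrightarrow> degree p \<le> degree q)"

text \<open>Leading coefficients survive by injectivity. This guarantees that the image of a minimal
  polynomial is nonconstant and so has a root to which \<open>x\<close> can be sent.\<close>

lemma poly_graph_degree:
  fixes R :: "('a::field alg_closure \<times> 'b::field) set"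
  assumes "hom_graph R" "range to_ac \<subseteq> Domain R" "poly_graph R p q"
  shows "degree q = degree p"
proof (cases "p = 0")
  case True
  then have "q = 0" using assms by (auto simp: poly_graph_def poly_eq_iff dest: hom_graphD(6))
  then show ?thesis using True by simp
next
  case False
  have "coeff q i = 0" if "i > degree p" for i
    using assms that coeff_eq_0[OF that] by (metis poly_graph_def hom_graphD(6))
  moreover have "coeff q (degree p) \<noteq> 0"
    using hom_graph_nonzero[OF assms(1,2)] assms(3) False by (metis poly_graph_def leading_coeff_0_iff)
  ultimately show ?thesis by (meson le_degree degree_le le_antisym)
qed

lemma minimal_poly_graph_exists:
  fixes R :: "('a::field alg_closure \<times> 'b::field) set"
  assumes R: "hom_graph R" "range to_ac \<subseteq> Domain R"
  obtains p p' where "minimal_poly_graph R x p p'"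
proof -
  obtain f :: "'a \<Rightarrow> 'b" where f: "(to_ac q, f q) \<in> R" for q
  proof -
    have "\<exists>b. (to_ac q, b) \<in> R" for q using R(2) by blast
    then show ?thesis using that by metis
  qed
  \<comment> \<open>The choice function \<open>f\<close> need not be additive; f 0 = 0 is what makes
    \<open>map_poly\<close> act coefficientwise.\<close>
  have f0: "f 0 = 0" using f[of 0] hom_graphD(6)[OF R(1)] by simp
  obtain p0 :: "'a poly" where p0: "p0 \<noteq> 0" "poly (map_poly to_ac p0) x = 0"
    by (rule alg_closure_algebraic)
  define P where "P = (\<lambda>(p, p'). poly_graph R p p' \<and> p \<noteq> 0 \<and> poly p x = 0)"
  have "map_poly to_ac p0 \<noteq> 0"
    using p0 by (metis map_poly_eq_0_iff to_ac_0 to_ac_eq_0_iff)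
  then have "P (map_poly to_ac p0, map_poly f p0)"
    using p0 f f0 by (auto simp: P_def poly_graph_def coeff_map_poly)
  then obtain pp where "P pp \<and> (\<forall>qq. P qq \<longrightarrow> degree (fst pp) \<le> degree (fst qq))"
    using ex_has_least_nat[of P _ "\<lambda>pp. degree (fst pp)"] by metis
  then show ?thesis using that[of "fst pp" "snd pp"]
    by (auto simp: P_def minimal_poly_graph_def case_prod_beta)
qed

text \<open>If \<open>q\<close> vanishes at \<open>x\<close> then so does \<open>q\<close> minus a multiple of the minimal polynomial that
  cancels the leading coefficient; this replaces division with remainder over the subring.\<close>

lemma minimal_poly_graph_root:
  fixes R :: "('a::field alg_closure \<times> 'b::field) set"
  assumes R: "hom_graph R" "range to_ac \<subseteq> Domain R"
    and p: "minimal_poly_graph R x p p'" and l: "poly p' l = 0"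
    and q: "poly_graph R q q'" "poly q x = 0"
  shows "poly q' l = 0"
  using q
proof (induction "degree q" arbitrary: q q' rule: less_induct)
  case less
  show ?case
  proof (cases "q = 0")
    case True
    then have "q' = 0" using less.prems R(1) by (auto simp: poly_graph_def poly_eq_iff dest: hom_graphD(6))
    then show ?thesis by simp
  next
    case False
    note pD = p[unfolded minimal_poly_graph_def]
    have deg: "degree p \<le> degree q" using pD less.prems False by blast
    obtain c where c: "(inverse (lead_coeff p), c) \<in> R"
      using subring_set_inverse[OF hom_graph_Domain[OF R(1)] R(2), of "lead_coeff p"] pD
      by (auto simp: poly_graph_def)
    define a b k where "a = lead_coeff q * inverse (lead_coeff p)"
      and "b = coeff q' (degree q) * c" and "k = degree q - degree p"
    have ab: "(a, b) \<in> R" unfolding a_def b_def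
      using less.prems c by (auto intro!: hom_graphD[OF R(1)] simp: poly_graph_def)
    define r r' where "r = q - monom a k * p" and "r' = q' - monom b k * p'"
    have "poly_graph R r r'"
      using less.prems pD ab unfolding poly_graph_def r_def r'_def coeff_diff coeff_monom_mult
      by (auto intro!: hom_graphD(3)[OF R(1)] hom_graphD(5)[OF R(1)]
          hom_graphD(2)[OF R(1)])
    moreover have "poly r x = 0" using less.prems pD by (simp add: r_def)
    moreover have "r = 0 \<or> degree r < degree q"
    proof -
      have "degree r \<le> degree q" unfolding r_def
        using deg by (intro degree_diff_le order.trans[OF degree_mult_le])
          (auto simp: k_def intro: order.trans[OF add_mono[OF degree_monom_le order.refl]])
      moreover have "coeff r (degree q) = 0"
        using deg pD by (auto simp: r_def coeff_monom_mult k_def a_def)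
      ultimately show ?thesis
        using eq_zero_or_degree_less by blast
    qed
    ultimately have "poly r' l = 0"
    proof (cases "r = 0")
      case True
      then show ?thesis using \<open>poly_graph R r r'\<close> R(1)
        by (metis hom_graphD(6) poly_0 poly_eq_iff poly_graph_def coeff_0)
    qed (use less.hyps in auto)
    then show ?thesis using l by (simp add: r'_def)
  qed
qed

text \<open>Sending q(x) to q'(l) is well defined because every relation of \<open>x\<close> over
  the domain also holds for \<open>l\<close>, by \<open>minimal_poly_graph_root\<close>.\<close>

lemma hom_graph_extend:
  fixes R :: "('a::field alg_closure \<times> 'b::field) set"
  assumes R: "hom_graph R" "range to_ac \<subseteq> Domain R"
    and p: "minimal_poly_graph R x p p'" and l: "poly p' l = 0"
  obtains R' where "hom_graph R'" "R \<subseteq> R'" "(x, l) \<in> R'"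
proof
  define R' where "R' = {(poly q x, poly q' l) | q q'. poly_graph R q q'}"
  show "hom_graph R'"
    unfolding hom_graph_def
  proof (intro conjI allI impI)
    have "poly_graph R 1 1" by (auto simp: poly_graph_def one_pCons coeff_pCons hom_graphD[OF R(1)] split: nat.splits)
    then show "(1, 1) \<in> R'" unfolding R'_def by (force intro!: exI[of _ 1])
    fix a b c d assume "(a, b) \<in> R'" "(c, d) \<in> R'"
    then obtain q q' r r' where q: "poly_graph R q q'" "a = poly q x" "b = poly q' l"
      and r: "poly_graph R r r'" "c = poly r x" "d = poly r' l" by (auto simp: R'_def)
    have "poly_graph R (q - r) (q' - r')"
      using q r by (auto simp: poly_graph_def intro: hom_graphD[OF R(1)])
    then show "(a - c, b - d) \<in> R'" unfolding R'_def using q r by (force intro!: exI[of _ "q - r"] exI[of _ "q' - r'"])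
    have "poly_graph R (q * r) (q' * r')"
      using q r by (auto simp: poly_graph_def coeff_mult intro!: hom_graph_sum hom_graphD(5)[OF R(1)] R(1))
    then show "(a * c, b * d) \<in> R'" unfolding R'_def using q r by (force intro!: exI[of _ "q * r"] exI[of _ "q' * r'"])
  next
    fix b assume "(0, b) \<in> R'"
    then show "b = 0" using minimal_poly_graph_root[OF R p l] by (auto simp: R'_def)
  qed
  show "R \<subseteq> R'"
  proof clarify
    fix a b assume "(a, b) \<in> R"
    then have "poly_graph R [:a:] [:b:]" by (auto simp: poly_graph_def coeff_pCons hom_graphD[OF R(1)] split: nat.splits)
    then show "(a, b) \<in> R'" unfolding R'_def by (force intro!: exI[of _ "[:a:]"] exI[of _ "[:b:]"])
  qed
  have "poly_graph R [:0, 1:] [:0, 1:]" by (auto simp: poly_graph_def coeff_pCons hom_graphD[OF R(1)] split: nat.splits)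
  then show "(x, l) \<in> R'" unfolding R'_def by (force intro!: exI[of _ "[:0, 1:]"])
qed

text \<open>A maximal graph is total: any \<open>x\<close> can be sent to a root of the image of its
  minimal polynomial, which exists in the algebraically closed target, and maximality puts that pair
  into the graph already.\<close>

lemma hom_graph_total:
  fixes R :: "('a::field alg_closure \<times> 'b::alg_closed_field) set"
  assumes R: "hom_graph R" "range to_ac \<subseteq> Domain R"
  obtains \<phi> where "field_hom \<phi>" "\<And>a b. (a, b) \<in> R \<Longrightarrow> \<phi> a = b"
proof -
  define \<A> where "\<A> = {S. hom_graph S \<and> R \<subseteq> S}"
  have "\<exists>M\<in>\<A>. \<forall>S\<in>\<A>. M \<subseteq> S \<longrightarrow> S = M"
  proof (rule subset_Zorn_nonempty)
    show "\<A> \<noteq> {}" using R by (auto simp: \<A>_def)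
    fix C assume C: "C \<noteq> {}" "subset.chain \<A> C"
    have "hom_graph (\<Union> C)"
      unfolding hom_graph_def
    proof (intro conjI allI impI)
      show "(1, 1) \<in> \<Union> C" using C by (auto simp: subset.chain_def \<A>_def hom_graph_def)
      fix a b c d assume "(a, b) \<in> \<Union> C" "(c, d) \<in> \<Union> C"
      then obtain S T where "S \<in> C" "T \<in> C" "(a, b) \<in> S" "(c, d) \<in> T" by blast
      then obtain U where "U \<in> C" "(a, b) \<in> U" "(c, d) \<in> U"
        using C(2) by (metis in_mono subset_chain_def)
      moreover have "hom_graph U" using \<open>U \<in> C\<close> C(2) by (auto simp: \<A>_def subset.chain_def)
      ultimately show "(a - c, b - d) \<in> \<Union> C" "(a * c, b * d) \<in> \<Union> C"
        using hom_graphD(3,5) by blast+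
    next
      fix b assume "(0, b) \<in> \<Union> C"
      then show "b = 0" using C(2) by (auto simp: \<A>_def subset.chain_def dest: hom_graphD(6))
    qed
    moreover have "R \<subseteq> \<Union> C"
    proof -
      obtain S where "S \<in> C" using C(1) by blast
      then have "R \<subseteq> S" using C(2) by (auto simp: subset_chain_def \<A>_def)
      then show ?thesis using \<open>S \<in> C\<close> by blast
    qed
    ultimately show "\<Union> C \<in> \<A>" by (simp add: \<A>_def)
  qed
  then obtain M where M\<A>: "M \<in> \<A>" and M_max: "\<forall>S\<in>\<A>. M \<subseteq> S \<longrightarrow> S = M" by (rule bexE)
  then have M: "hom_graph M" "R \<subseteq> M" by (simp_all add: \<A>_def)
  have max: "S = M" if "hom_graph S" "M \<subseteq> S" for S
    using M_max that subset_trans[OF M(2) that(2)] by (simp add: \<A>_def)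
  have dom: "range to_ac \<subseteq> Domain M" using R(2) Domain_mono[OF M(2)] by (rule subset_trans)
  have "\<exists>y. (x, y) \<in> M" for x
  proof -
    obtain p p' where p: "minimal_poly_graph M x p p'"
      using minimal_poly_graph_exists[OF M(1) dom] .
    have "degree p' = degree p"
      using p poly_graph_degree[OF M(1) dom] by (simp add: minimal_poly_graph_def)
    moreover have "degree p > 0"
    proof (rule ccontr)
      assume "\<not> degree p > 0"
      then obtain c where "p = [:c:]" by (auto elim: degree_eq_zeroE)
      then show False using p by (auto simp: minimal_poly_graph_def)
    qed
    ultimately obtain l where "poly p' l = 0"
      using alg_closed_imp_poly_has_root[of p'] by auto
    then obtain R' where "hom_graph R'" "M \<subseteq> R'" "(x, l) \<in> R'"
      using hom_graph_extend[OF M(1) dom p] by blast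
    then show ?thesis using max by blast
  qed
  then obtain \<phi> where \<phi>: "(x, \<phi> x) \<in> M" for x by metis
  have eq: "\<phi> x = y" if "(x, y) \<in> M" for x y using \<phi> that hom_graphD(7)[OF M(1)] by blast
  show ?thesis
  proof
    show "field_hom \<phi>"
      using hom_graphD(1,2,4,5)[OF M(1)] \<phi> by unfold_locales (auto intro!: eq)
    show "\<phi> a = b" if "(a, b) \<in> R" for a b using that M(2) eq by blast
  qed
qed

section \<open>Existence and surjectivity of automorphisms\<close>

lemma alg_closure_hom_extend:
  fixes h :: "'a::field \<Rightarrow> 'b::alg_closed_field"
  assumes "field_hom h"
  obtains \<phi> where "field_hom \<phi>" "\<And>a. \<phi> (to_ac a) = h a"
proof -
  interpret field_hom h by fact
  define R where "R = range (\<lambda>a. (to_ac a, h a))"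
  have "(to_ac a, h a) \<in> R" for a by (simp add: R_def)
  note this[of 1] this[of "_ - _"] this[of "_ * _"]
  then have "hom_graph R" by (auto simp: hom_graph_def R_def hom_distribs)
  moreover have "range to_ac \<subseteq> Domain R" by (auto simp: R_def)
  ultimately obtain \<phi> where "field_hom \<phi>" "\<And>a b. (a, b) \<in> R \<Longrightarrow> \<phi> a = b"
    using hom_graph_total by blast
  then show ?thesis using that[of \<phi>] by (auto simp: R_def)
qed

text \<open>This is the half of Galois theory in use: an element fixed by all automorphisms over K
  lies in K. Outside K the minimal polynomial has degree at least 2, and in characteristic 0 its
  roots are simple, so there is another root to move \<open>x\<close> to.\<close>

lemma automorphism_moving:
  fixes K :: "'a::field_char_0 alg_closure set"
  assumes K: "subring_set K" "range to_ac \<subseteq> K" and x: "x \<notin> K"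
  obtains \<sigma> :: "'a alg_closure \<Rightarrow> 'a alg_closure"
    where "field_hom \<sigma>" "\<And>u. u \<in> K \<Longrightarrow> \<sigma> u = u" "\<sigma> x \<noteq> x"
proof -
  have R: "hom_graph (Id_on K)" "range to_ac \<subseteq> Domain (Id_on K)"
    using K by (auto simp: hom_graph_def intro: subring_setD)
  obtain p p' where p: "minimal_poly_graph (Id_on K) x p p'"
    using minimal_poly_graph_exists[OF R] .
  have "p' = p" using p by (auto simp: minimal_poly_graph_def poly_graph_def poly_eq_iff)
  note p = p[unfolded this]
  have coeffs: "coeff p i \<in> K" for i using p by (auto simp: minimal_poly_graph_def poly_graph_def)
  have px: "p \<noteq> 0" "poly p x = 0" using p by (auto simp: minimal_poly_graph_def)
  then obtain q where q: "p = [:-x, 1:] * q" by (auto simp: poly_eq_0_iff_dvd)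
  have "q \<noteq> 0" using px q by auto
  have degp: "degree p = Suc (degree q)" unfolding q using \<open>q \<noteq> 0\<close> by (subst degree_mult_eq) auto
  have "degree q > 0"
  proof (rule ccontr)
    assume "\<not> degree q > 0"
    then obtain c where c: "q = [:c:]" by (auto elim: degree_eq_zeroE)
    have "c \<noteq> 0" using c \<open>q \<noteq> 0\<close> by auto
    then have "x = - coeff p 0 * inverse (coeff p 1)" unfolding q c by simp
    also have "\<dots> \<in> K" using K coeffs by (intro subring_setD(4,6) subring_set_inverse) auto
    finally show False using x by simp
  qed
  then obtain l where l: "poly q l = 0" using alg_closed_imp_poly_has_root by blast
  have "l \<noteq> x"
  \<comment> \<open>A double root at \<open>x\<close> would be a root of the derivative, a nonzero
    polynomial over K of smaller degree.\<close>
  proof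
    assume "l = x"
    then have "poly (pderiv p) x = 0" using l by (simp add: q pderiv_mult pderiv_pCons del: mult_pCons_left)
    moreover have "poly_graph (Id_on K) (pderiv p) (pderiv p)"
      using coeffs K by (auto simp: poly_graph_def coeff_pderiv intro: subring_setD)
    moreover have "pderiv p \<noteq> 0" using degp by (simp add: pderiv_eq_0_iff)
    ultimately have "degree p \<le> degree (pderiv p)" using p by (auto simp: minimal_poly_graph_def)
    then show False using degp by (simp add: degree_pderiv)
  qed
  have "poly p l = 0" using l by (simp add: q)
  then obtain R' where R': "hom_graph R'" "Id_on K \<subseteq> R'" "(x, l) \<in> R'"
    using hom_graph_extend[OF R p] by blast
  have "range to_ac \<subseteq> Domain R'" using R(2) Domain_mono[OF R'(2)] by (rule subset_trans)
  then obtain \<sigma> where "field_hom \<sigma>" "\<And>a b. (a, b) \<in> R' \<Longrightarrow> \<sigma> a = b"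
    using hom_graph_total[OF R'(1)] by blast
  then show ?thesis using that[of \<sigma>] R' \<open>l \<noteq> x\<close> by auto
qed

text \<open>Each element lies in the finite root set of a polynomial over the base field, and an
  injective self-map of a finite set is onto.\<close>

lemma alg_closure_endo_surj:
  fixes \<sigma> :: "'a::field alg_closure \<Rightarrow> 'a alg_closure"
  assumes "field_hom \<sigma>" and fix_base: "\<And>a. \<sigma> (to_ac a) = to_ac a"
  shows "surj \<sigma>"
proof -
  interpret field_hom \<sigma> by fact
  have "y \<in> range \<sigma>" for y
  proof -
    obtain p :: "'a poly" where p: "p \<noteq> 0" "poly (map_poly to_ac p) y = 0"
      by (rule alg_closure_algebraic)
    define Z where "Z = {z. poly (map_poly to_ac p) z = 0}"
    have "map_poly to_ac p \<noteq> 0"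
      using p by (metis map_poly_eq_0_iff to_ac_0 to_ac_eq_0_iff)
    then have "finite Z" by (simp add: Z_def poly_roots_finite)
    have "map_poly \<sigma> (map_poly to_ac p) = map_poly to_ac p"
      by (simp add: poly_eq_iff coeff_map_poly fix_base)
    then have "\<sigma> ` Z \<subseteq> Z" by (metis (mono_tags, lifting) Z_def hom_zero image_subsetI mem_Collect_eq poly_map_poly)
    moreover have "inj_on \<sigma> Z" by (auto intro!: inj_onI)
    ultimately have "\<sigma> ` Z = Z" using \<open>finite Z\<close> by (simp add: endo_inj_surj)
    then show ?thesis using p by (auto simp: Z_def)
  qed
  then show ?thesis by blast
qed

section \<open>Hensel's lemma and homomorphisms on fields of fractions\<close>

lemma poly_taylor2:
  fixes p :: "'a::idom poly"
  shows "\<exists>r. poly p (z + h) = poly p z + h * poly (pderiv p) z + h\<^sup>2 * r"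
proof (induction p)
  case (pCons a p)
  then obtain r where "poly p (z + h) = poly p z + h * poly (pderiv p) z + h\<^sup>2 * r" by blast
  then show ?case
    by (intro exI[of _ "poly (pderiv p) z + z * r + h * r"])
      (simp add: pderiv_pCons algebra_simps power2_eq_square)
qed auto

lemma fps_nth_0_poly: "fps_nth (poly p z) 0 = poly (map_poly (\<lambda>f. fps_nth f 0) p) (fps_nth z 0)"
  for z :: "'a::comm_ring_1 fps"
  by (induction p) (auto simp: map_poly_pCons)

text \<open>Newton iteration in its linear form: step n adds a multiple of t^(n+1) chosen to cancel
  coefficient n+1 of the value, and leaves all lower coefficients alone. The diagonal coefficients
  form the limit.\<close>

lemma fps_hensel:
  fixes p :: "'a::field fps poly"
  assumes root: "fps_nth (poly p (fps_const d)) 0 = 0"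
    and simple: "fps_nth (poly (pderiv p) (fps_const d)) 0 \<noteq> 0"
  obtains w where "poly p w = 0" "fps_nth w 0 = d"
proof -
  define s where "s = fps_nth (poly (pderiv p) (fps_const d)) 0"
  define z where "z = rec_nat (fps_const d)
    (\<lambda>n z. z + fps_X ^ Suc n * fps_const (- fps_nth (poly p z) (Suc n) / s))"
  have z_simps: "z 0 = fps_const d"
    "z (Suc n) = z n + fps_X ^ Suc n * fps_const (- fps_nth (poly p (z n)) (Suc n) / s)" for n
    by (simp_all add: z_def)
  have X_nth: "fps_nth (fps_X ^ k * f) i = (if i < k then 0 else fps_nth f (i - k))" for k i and f :: "'a fps"
    by (simp add: fps_X_power_mult_nth)
  have z0: "fps_nth (z n) 0 = d" for n
    by (induction n) (simp_all only: z_simps fps_add_nth X_nth, simp_all)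
  \<comment> \<open>The constant coefficient of the derivative depends on \<open>z n\<close> only
    through its constant term \<open>d\<close>, so the same divisor \<open>s\<close> serves every
    step.\<close>
  have ds: "fps_nth (poly (pderiv p) (z n)) 0 = s" for n
    using z0[of n] by (simp add: s_def fps_nth_0_poly)
  have pz: "fps_nth (poly p (z n)) i = 0" if "i \<le> n" for n i
    using that
  proof (induction n arbitrary: i)
    case 0
    then show ?case using root by (simp add: z_simps)
  next
    case (Suc n)
    define c where "c = - fps_nth (poly p (z n)) (Suc n) / s"
    obtain r where r: "poly p (z (Suc n)) = poly p (z n) + fps_X ^ Suc n * fps_const c * poly (pderiv p) (z n)
        + (fps_X ^ Suc n * fps_const c)\<^sup>2 * r"
      using poly_taylor2[of p "z n" "fps_X ^ Suc n * fps_const c"] unfolding z_simps c_def by blast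
    also have "\<dots> = poly p (z n) + fps_X ^ Suc n * (fps_const c * poly (pderiv p) (z n)
        + fps_X ^ Suc n * ((fps_const c)\<^sup>2 * r))"
      by (simp add: algebra_simps power2_eq_square)
    finally have eq: "fps_nth (poly p (z (Suc n))) i = fps_nth (poly p (z n)) i +
      (if i < Suc n then 0 else c * fps_nth (poly (pderiv p) (z n)) (i - Suc n) +
        (if i - Suc n < Suc n then 0 else fps_nth ((fps_const c)\<^sup>2 * r) (i - Suc n - Suc n)))"
      by (simp only: fps_add_nth X_nth fps_mult_left_const_nth)
    show ?case
    proof (cases "i = Suc n")
      case True
      then show ?thesis unfolding eq using ds[of n] simple by (simp add: c_def s_def)
    next
      case False
      then show ?thesis unfolding eq using Suc by auto
    qed
  qed
  have stable: "fps_nth (z n) i = fps_nth (z i) i" if "i \<le> n" for n i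
    using that by (induction n rule: dec_induct) (simp_all only: z_simps fps_add_nth X_nth, simp_all)
  define w where "w = Abs_fps (\<lambda>i. fps_nth (z i) i)"
  have "fps_nth (poly p w) n = 0" for n
  proof -
    define g where "g = fps_shift (Suc n) (w - z n)"
    have "w - z n = fps_X ^ Suc n * g"
    proof (rule fps_ext)
      fix i
      have "fps_nth (w - z n) i = 0" if "i \<le> n" using stable[OF that] by (simp add: w_def)
      then show "fps_nth (w - z n) i = fps_nth (fps_X ^ Suc n * g) i"
        unfolding X_nth g_def by (cases "i < Suc n") (simp_all del: power_Suc fps_sub_nth)
    qed
    \<comment> \<open>Values of a polynomial differ by a multiple of the difference of the
      arguments, here divisible by t^(n+1); thus coefficient n of the value at \<open>w\<close> is
      that at \<open>z n\<close>, which is zero.\<close>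
    moreover have "w - z n dvd poly p w - poly p (z n)"
    proof (induction p)
      case (pCons a p)
      have "poly (pCons a p) w - poly (pCons a p) (z n) = (w - z n) * poly p w + z n * (poly p w - poly p (z n))"
        by (simp add: algebra_simps)
      then show ?case using pCons by (metis dvd_add dvd_mult dvd_triv_left)
    qed auto
    ultimately obtain k where "poly p w - poly p (z n) = fps_X ^ Suc n * (g * k)"
      by (metis dvd_def mult.assoc)
    then have "fps_nth (poly p w - poly p (z n)) n = 0" by (simp add: X_nth del: power_Suc)
    then show ?thesis using pz[of n n] by simp
  qed
  then have "poly p w = 0" by (intro fps_ext) simp
  moreover have "fps_nth w 0 = d" by (simp add: w_def z_simps)
  ultimately show ?thesis by (rule that)
qed

section \<open>Homomorphisms on fraction fields and transcendental elements\<close>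

lemma fract_hom_extend:
  fixes e :: "'a::idom \<Rightarrow> 'b::field"
  assumes "idom_hom e" and inj: "\<And>a. e a = 0 \<Longrightarrow> a = 0"
  obtains \<psi> where "field_hom \<psi>" "\<And>a b. b \<noteq> 0 \<Longrightarrow> \<psi> (Fract a b) = e a / e b"
proof -
  interpret idom_hom e by fact
  define \<psi> where "\<psi> = (\<lambda>r. SOME z. \<exists>a b. b \<noteq> 0 \<and> r = Fract a b \<and> z = e a / e b)"
  have \<psi>: "\<psi> (Fract a b) = e a / e b" if "b \<noteq> 0" for a b
    unfolding \<psi>_def
  proof (rule some_equality)
    fix z assume "\<exists>c d. d \<noteq> 0 \<and> Fract a b = Fract c d \<and> z = e c / e d"
    then obtain c d where cd: "d \<noteq> 0" "Fract a b = Fract c d" "z = e c / e d" by blast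
    then have "a * d = c * b" using that by (simp add: eq_fract)
    then have "e a * e d = e c * e b" by (metis hom_mult)
    moreover have "e b \<noteq> 0" "e d \<noteq> 0" using that cd inj by auto
    ultimately show "z = e a / e b" by (simp add: cd(3) frac_eq_eq)
  qed (use that in blast)
  have e0: "b \<noteq> 0 \<Longrightarrow> e b \<noteq> 0" for b using inj by blast
  have "field_hom \<psi>"
  proof unfold_locales
    show "\<psi> 0 = 0" "\<psi> 1 = 1" using \<psi>[of 1 0] \<psi>[of 1 1] by (simp_all add: Zero_fract_def One_fract_def)
    show "\<psi> (x + y) = \<psi> x + \<psi> y" for x y
      by (cases x; cases y) (simp add: \<psi> e0 hom_distribs field_simps)
    show "\<psi> (x * y) = \<psi> x * \<psi> y" for x y
      by (cases x; cases y) (simp add: \<psi> hom_distribs)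
  qed
  then show ?thesis using that \<psi> by blast
qed

text \<open>Over an algebraically closed field p splits into linear factors, and x - h r is nonzero
  for x outside the image. It makes substitution of a nonconstant series injective and, by
  contraposition, turns roots of polynomials with constant coefficients into constants.\<close>

lemma poly_transcendental:
  fixes h :: "'a::alg_closed_field \<Rightarrow> 'b::field"
  assumes "field_hom h" "x \<notin> range h" "poly (map_poly h p) x = 0"
  shows "p = 0"
proof (rule ccontr)
  interpret field_hom h by fact
  interpret H: map_poly_idom_hom h ..
  assume "p \<noteq> 0"
  then show False using assms(3)
  proof (induction "degree p" arbitrary: p)
    case 0
    then obtain c where "p = [:c:]" by (metis degree_eq_zeroE)
    then show ?case using 0 by auto
  next
    case (Suc n)
    then obtain r where "poly p r = 0" using alg_closed_imp_poly_has_root[of p] by auto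
    then obtain q where q: "p = [:-r, 1:] * q" by (auto simp: poly_eq_0_iff_dvd)
    have "q \<noteq> 0" using Suc q by auto
    then have "degree q = n" using Suc(2) unfolding q by (subst (asm) degree_mult_eq) auto
    have "poly (map_poly h p) x = (x - h r) * poly (map_poly h q) x"
      unfolding q by (simp add: hom_distribs algebra_simps)
    moreover have "x - h r \<noteq> 0" using assms(2) by auto
    ultimately show ?case using Suc \<open>degree q = n\<close> \<open>q \<noteq> 0\<close> by auto
  qed
qed

section \<open>Places of the field of algebraic functions\<close>

lemma fun_const_hom: "field_hom fun_const"
  by unfold_locales (simp_all add: fun_const_def Zero_fract_def[symmetric] One_fract_def[symmetric]
      to_ac_add[symmetric] to_ac_mult[symmetric] del: to_ac_add to_ac_mult add: one_pCons[symmetric] mult.commute)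

lemma fls_const_hom: "field_hom (fls_const :: 'a::field \<Rightarrow> 'a fls)"
  by unfold_locales (simp_all add: fls_plus_const)

lemma fps_const_hom: "idom_hom (fps_const :: 'a::idom \<Rightarrow> 'a fps)"
  by unfold_locales simp_all

text \<open>The power series inside the algebraic closure of the Laurent series: an algebraic
  function sent into this range has no pole at the place, and the constant term is its value
  there.\<close>

definition ser :: "'a::field fps \<Rightarrow> 'a fls alg_closure" where
  "ser f = to_ac (fps_to_fls f)"

lemma ser_hom: "idom_hom ser"
  by unfold_locales (simp_all add: ser_def fls_times_fps_to_fls)

lemma ser_eq_iff [simp]: "ser f = ser g \<longleftrightarrow> f = g"
  by (simp add: ser_def)

lemma ser_poly:
  "poly (map_poly (\<lambda>c. ser (fps_const c)) p) (ser f) = ser (poly (map_poly fps_const p) f)"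
proof -
  interpret idom_hom ser by (rule ser_hom)
  have "map_poly (\<lambda>c. ser (fps_const c)) p = map_poly ser (map_poly fps_const p)"
    by (simp add: poly_eq_iff coeff_map_poly)
  then show ?thesis by simp
qed

text \<open>\<xi> is the expansion of x in the local parameter: a power series over a finite point,
  a series with a pole over infinity. The target is an algebraic closure, so that the embedding
  exists before the solutions are known to have expansions in integer powers.\<close>

definition place :: "(algfun \<Rightarrow> complex fls alg_closure) \<Rightarrow> complex fls \<Rightarrow> bool" where
  "place \<Phi> \<xi> \<longleftrightarrow> field_hom \<Phi> \<and> (\<forall>c. \<Phi> (fun_const c) = ser (fps_const c)) \<and> \<Phi> fun_x = to_ac \<xi> \<and>
    (\<forall>a b. b \<noteq> 0 \<longrightarrow> poly (map_poly fls_const b) \<xi> \<noteq> 0 \<and>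
      \<Phi> (to_ac (Fract a b)) = to_ac (poly (map_poly fls_const a) \<xi> / poly (map_poly fls_const b) \<xi>))"

lemma placeD:
  assumes "place \<Phi> \<xi>"
  shows "field_hom \<Phi>" "\<Phi> (fun_const c) = ser (fps_const c)" "\<Phi> fun_x = to_ac \<xi>"
    "b \<noteq> 0 \<Longrightarrow> poly (map_poly fls_const b) \<xi> \<noteq> 0"
    "b \<noteq> 0 \<Longrightarrow>
      \<Phi> (to_ac (Fract a b)) = to_ac (poly (map_poly fls_const a) \<xi> / poly (map_poly fls_const b) \<xi>)"
  using assms by (simp_all add: place_def del: to_ac_divide)

text \<open>Substituting a nonconstant \<xi> for x is injective on polynomials, hence extends to
  rational functions and then to their algebraic closure.\<close>

lemma place_exists:
  fixes \<xi> :: "complex fls"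
  assumes "\<xi> \<notin> range fls_const"
  obtains \<Phi> where "place \<Phi> \<xi>"
proof -
  define e where "e = (\<lambda>p. poly (map_poly fls_const p) \<xi>)"
  have e0: "p = 0" if "e p = 0" for p
    using poly_transcendental[OF fls_const_hom assms] that by (simp add: e_def)
  interpret f: field_hom "fls_const :: complex \<Rightarrow> _" by (rule fls_const_hom)
  interpret F: map_poly_idom_hom "fls_const :: complex \<Rightarrow> _" ..
  have "idom_hom e" by unfold_locales (simp_all add: e_def F.hom_add F.hom_mult)
  then obtain \<psi> where \<psi>: "field_hom \<psi>" "\<And>a b. b \<noteq> 0 \<Longrightarrow> \<psi> (Fract a b) = e a / e b"
    using fract_hom_extend e0 by metis
  have "field_hom (\<lambda>r. to_ac (\<psi> r))"
  proof -
    interpret field_hom \<psi> by fact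
    show ?thesis by unfold_locales (simp_all add: hom_add hom_mult)
  qed
  then obtain \<Phi> where \<Phi>: "field_hom \<Phi>" "\<And>r. \<Phi> (to_ac r) = to_ac (\<psi> r)"
    using alg_closure_hom_extend by blast
  have "\<Phi> (fun_const c) = ser (fps_const c)" for c
    by (simp add: fun_const_def \<Phi> \<psi> e_def ser_def f.map_poly_pCons_hom)
  moreover have "\<Phi> fun_x = to_ac \<xi>"
    by (simp add: fun_x_def \<Phi> \<psi> e_def map_poly_pCons)
  moreover have "poly (map_poly fls_const b) \<xi> \<noteq> 0 \<and>
      \<Phi> (to_ac (Fract a b)) = to_ac (poly (map_poly fls_const a) \<xi> / poly (map_poly fls_const b) \<xi>)"
    if "b \<noteq> 0" for a b
  proof
    show "poly (map_poly fls_const b) \<xi> \<noteq> 0" using e0[of b] that by (auto simp: e_def)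
    show "\<Phi> (to_ac (Fract a b)) = to_ac (poly (map_poly fls_const a) \<xi> / poly (map_poly fls_const b) \<xi>)"
      by (simp only: \<Phi>(2) \<psi>(2)[OF that] e_def)
  qed
  ultimately show ?thesis by (intro that[of \<Phi>]) (simp add: place_def \<Phi>(1) del: to_ac_divide)
qed

section \<open>The solutions and their images under a place\<close>

definition fiber :: "complex poly \<Rightarrow> algfun set" where
  "fiber P = {z. poly (map_poly fun_const P) z = fun_x}"

text \<open>As p splits already in the source, its image splits into the images of the linear
  factors and acquires no new roots in the larger field.\<close>

lemma hom_image_roots:
  fixes p :: "'a::alg_closed_field poly" and \<Phi> :: "'a \<Rightarrow> 'b::field"
  assumes "field_hom \<Phi>" "p \<noteq> 0"
  shows "\<Phi> ` {z. poly p z = 0} = {w. poly (map_poly \<Phi> p) w = 0}"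
proof -
  interpret f: field_hom \<Phi> by fact
  interpret F: map_poly_idom_hom \<Phi> ..
  obtain A where A: "p = smult (lead_coeff p) (\<Prod>x\<in>#A. [:-x, 1:])"
    using alg_closed_imp_factorization[OF assms(2)] by blast
  have "w \<in> \<Phi> ` {z. poly p z = 0}" if "poly (map_poly \<Phi> p) w = 0" for w
  proof -
    have "map_poly \<Phi> p = smult (\<Phi> (lead_coeff p)) (\<Prod>x\<in>#A. [:- \<Phi> x, 1:])"
      by (subst A) (simp add: f.map_poly_hom_smult F.hom_prod_mset map_poly_pCons f.hom_uminus image_mset.compositionality o_def del: F.prod_mset_image)
    then have "(\<Prod>x\<in>#A. w - \<Phi> x) = 0"
      using that assms(2) by (simp add: poly_prod_mset image_mset.compositionality o_def)
    then obtain x where "x \<in># A" "w = \<Phi> x" by auto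
    moreover have "poly p x = 0"
      using \<open>x \<in># A\<close> by (subst A) (force simp: poly_prod_mset image_mset.compositionality o_def)
    ultimately show ?thesis by blast
  qed
  then show ?thesis by auto
qed

text \<open>Every series solution found at a place is thereby the image of an actual solution, which
  allows the fiber to be counted on the series side.\<close>

lemma fiber_image:
  assumes "place \<Phi> \<xi>" "degree P > 0"
  shows "\<Phi> ` fiber P = {w. poly (map_poly (\<lambda>c. ser (fps_const c)) P) w = to_ac \<xi>}"
proof -
  interpret f: field_hom \<Phi> by (rule placeD(1)[OF assms(1)])
  interpret c: field_hom fun_const by (rule fun_const_hom)
  define p where "p = map_poly fun_const P - [:fun_x:]"
  have "coeff p (degree P) = fun_const (lead_coeff P)"
    using assms(2) by (simp add: p_def coeff_pCons split: nat.splits)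
  then have "p \<noteq> 0" using assms(2) by fastforce
  moreover have "map_poly \<Phi> p = map_poly (\<lambda>c. ser (fps_const c)) P - [:to_ac \<xi>:]"
    by (rule poly_eqI) (simp add: p_def coeff_map_poly coeff_pCons placeD[OF assms(1)] f.hom_minus idom_hom.axioms ser_def split: nat.splits)
  ultimately show ?thesis
    using hom_image_roots[OF f.field_hom_axioms, of p] by (simp add: p_def fiber_def)
qed

lemma finite_fiber:
  assumes "degree P > 0" shows "finite (fiber P)"
proof -
  interpret c: field_hom fun_const by (rule fun_const_hom)
  define p where "p = map_poly fun_const P - [:fun_x:]"
  have "coeff p (degree P) = fun_const (lead_coeff P)"
    using assms by (simp add: p_def coeff_pCons split: nat.splits)
  then have "p \<noteq> 0" using assms by fastforce
  then have "finite {z. poly p z = 0}" by (rule poly_roots_finite)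
  then show ?thesis by (simp add: p_def fiber_def)
qed

section \<open>Power series solutions over a finite point\<close>

lemma fps_roots_bound:
  fixes P :: "complex poly"
  assumes "degree P > 0"
  shows "finite {w. poly (map_poly fps_const P) w = \<xi>}"
    "card {w. poly (map_poly fps_const P) w = \<xi>} \<le> degree P"
proof -
  define p where "p = map_poly fps_const P - [:\<xi>:]"
  have c: "coeff p (degree P) = fps_const (lead_coeff P)"
    using assms by (simp add: p_def coeff_pCons coeff_map_poly split: nat.splits)
  then have "p \<noteq> 0" using assms by fastforce
  have "degree p \<le> degree P" unfolding p_def
    by (intro degree_diff_le) (auto intro: degree_map_poly_le)
  moreover have "{w. poly (map_poly fps_const P) w = \<xi>} = {w. poly p w = 0}" by (auto simp: p_def)
  ultimately show "finite {w. poly (map_poly fps_const P) w = \<xi>}"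
    "card {w. poly (map_poly fps_const P) w = \<xi>} \<le> degree P"
    using poly_roots_finite[OF \<open>p \<noteq> 0\<close>] card_poly_roots_bound[OF \<open>p \<noteq> 0\<close>] by auto
qed

lemma fps_nth_0_poly_const:
  fixes P :: "'a::idom poly"
  shows "fps_nth (poly (map_poly fps_const P) w) 0 = poly P (fps_nth w 0)"
proof -
  have "map_poly (\<lambda>f. fps_nth f 0) (map_poly fps_const P) = P"
    by (simp add: poly_eq_iff coeff_map_poly)
  then show ?thesis by (simp add: fps_nth_0_poly)
qed

lemma fps_compose_poly_const:
  fixes P :: "'a::idom poly"
  assumes "fps_nth \<theta> 0 = 0"
  shows "poly (map_poly fps_const P) w oo \<theta> = poly (map_poly fps_const P) (w oo \<theta>)"
  by (induction P) (simp_all add: map_poly_pCons fps_compose_add_distrib fps_compose_mult_distrib[OF assms])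

lemma pderiv_map_fps_const: "pderiv (map_poly fps_const P) = map_poly fps_const (pderiv P)"
  for P :: "'a::idom poly"
proof -
  interpret idom_hom "fps_const :: 'a \<Rightarrow> _" by (rule fps_const_hom)
  show ?thesis by (simp add: map_poly_pderiv)
qed

lemma simple_root_series:
  fixes P :: "complex poly"
  assumes "poly P d = fps_nth \<xi> 0" "poly (pderiv P) d \<noteq> 0"
  obtains w where "poly (map_poly fps_const P) w = \<xi>" "fps_nth w 0 = d"
proof -
  define p where "p = map_poly fps_const P - [:\<xi>:]"
  have "fps_nth (poly p (fps_const d)) 0 = 0"
    by (simp add: p_def fps_nth_0_poly_const assms)
  moreover have "fps_nth (poly (pderiv p) (fps_const d)) 0 \<noteq> 0"
    by (simp add: p_def pderiv_diff pderiv_pCons pderiv_map_fps_const fps_nth_0_poly_const assms)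
  ultimately obtain w where "poly p w = 0" "fps_nth w 0 = d" using fps_hensel by blast
  then show ?thesis using that by (simp add: p_def)
qed

lemma fps_const_plus_X_not_const: "fps_const c + fps_X \<noteq> fps_const (d :: 'a::field)"
proof
  assume "fps_const c + fps_X = fps_const d"
  then have "fps_nth (fps_const c + fps_X) 1 = fps_nth (fps_const d) 1" by simp
  then show False by simp
qed

lemma poly_fps_const_plus_X_eq_0:
  fixes P :: "complex poly"
  assumes "poly (map_poly fps_const P) (fps_const c + fps_X) = 0"
  shows "P = 0"
proof (rule poly_transcendental[OF fls_const_hom])
  have "fps_to_fls (fps_const c + fps_X) \<noteq> fps_to_fls (fps_const d)" for d
    using fps_const_plus_X_not_const[of c d] by (simp only: fps_to_fls_eq_iff not_False_eq_True)
  then show "fps_to_fls (fps_const c + fps_X) \<notin> range fls_const" by auto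
  interpret comm_ring_hom "fps_to_fls :: complex fps \<Rightarrow> _"
    by unfold_locales (simp_all add: fls_times_fps_to_fls)
  have "map_poly fls_const P = map_poly fps_to_fls (map_poly fps_const P)"
    by (simp add: poly_eq_iff coeff_map_poly)
  then show "poly (map_poly fls_const P) (fps_to_fls (fps_const c + fps_X)) = 0"
    using assms by (simp only: poly_map_poly) simp
qed

text \<open>Hensel's lemma is applied to the quotient \<open>(P(Y) - P(c + t)) / (Y - (c + t))\<close>, whose
  reduction modulo \<open>t\<close> has a simple root at \<open>c\<close>.\<close>

lemma double_root_series:
  fixes P :: "complex poly"
  assumes c: "poly (pderiv P) c = 0" "poly (pderiv (pderiv P)) c \<noteq> 0"
  obtains w where "poly (map_poly fps_const P) w = poly (map_poly fps_const P) (fps_const c + fps_X)"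
    "fps_nth w 0 = c" "w \<noteq> fps_const c + fps_X"
proof -
  define \<eta> where "\<eta> = fps_const c + (fps_X :: complex fps)"
  define p where "p = map_poly fps_const P - [:poly (map_poly fps_const P) \<eta>:]"
  have "poly p \<eta> = 0" by (simp add: p_def)
  then obtain F where F: "p = [:-\<eta>, 1:] * F" by (auto simp: poly_eq_0_iff_dvd)
  have p': "pderiv p = F + [:-\<eta>, 1:] * pderiv F"
    unfolding F by (simp add: pderiv_mult pderiv_pCons del: mult_pCons_left)
  have p'': "pderiv (pderiv p) = pderiv F + pderiv F + [:-\<eta>, 1:] * pderiv (pderiv F)"
    unfolding p' by (simp add: pderiv_add pderiv_mult pderiv_pCons del: mult_pCons_left)
  have d1: "pderiv p = map_poly fps_const (pderiv P)"
    by (simp add: p_def pderiv_diff pderiv_pCons pderiv_map_fps_const)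
  \<comment> \<open>Modulo t one has p = (Y - c) F, so at c the first derivative of p is F and the
    second is twice the derivative of F.\<close>
  have "fps_nth (poly F (fps_const c)) 0 = fps_nth (poly (pderiv p) (fps_const c)) 0"
    unfolding p' by (simp add: \<eta>_def)
  then have "fps_nth (poly F (fps_const c)) 0 = 0"
    by (simp add: d1 fps_nth_0_poly_const c)
  moreover have "fps_nth (poly (pderiv (pderiv p)) (fps_const c)) 0 = 2 * fps_nth (poly (pderiv F) (fps_const c)) 0"
    unfolding p'' by (simp add: \<eta>_def)
  then have "fps_nth (poly (pderiv F) (fps_const c)) 0 \<noteq> 0"
    using c by (auto simp: d1 pderiv_map_fps_const fps_nth_0_poly_const)
  ultimately obtain w where w: "poly F w = 0" "fps_nth w 0 = c" using fps_hensel by blast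
  \<comment> \<open>Otherwise \<eta> = c + t would be a double root of p, hence a zero of P'; as c +
    t is transcendental over the constants, this forces P' = 0.\<close>
  have "w \<noteq> \<eta>"
  proof
    assume "w = \<eta>"
    then have "poly (pderiv p) \<eta> = 0" using w by (simp add: p')
    then have "pderiv P = 0" unfolding d1 \<eta>_def by (rule poly_fps_const_plus_X_eq_0)
    then show False using c by simp
  qed
  moreover have "poly p w = 0" using w by (simp add: F)
  ultimately show ?thesis using that[of w] w by (simp add: p_def \<eta>_def)
qed

lemma degree_eq_sum_order:
  fixes p :: "complex poly"
  assumes "p \<noteq> 0"
  shows "degree p = (\<Sum>d\<in>{d. poly p d = 0}. order d p)"
  using size_proots_complex[of p] assms by (simp add: size_multiset_overloaded_eq)

text \<open>Simple roots of P - P(c) lift by Hensel's lemma, and c + t is a solution by the choice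
  of \<xi>. If c is critical it counts twice, and its second solution c + \<theta>(t) gives the
  substitution \<theta>, the algebraic substitute for one turn around the critical value. If c is
  not critical, constant terms are distinct and no pair collides.\<close>

lemma fiber_series:
  fixes P :: "complex poly" and c :: complex
  defines "\<xi> \<equiv> poly (map_poly fps_const P) (fps_const c + fps_X)"
  assumes P: "degree P > 0"
    and other: "\<And>d. d \<noteq> c \<Longrightarrow> poly P d = poly P c \<Longrightarrow> poly (pderiv P) d \<noteq> 0"
    and dbl: "poly (pderiv P) c = 0 \<Longrightarrow> poly (pderiv (pderiv P)) c \<noteq> 0"
  defines "W \<equiv> {w. poly (map_poly fps_const P) w = \<xi>}"
  shows "card W = degree P"
    and "\<And>w w'. w \<in> W \<Longrightarrow> w' \<in> W \<Longrightarrow> w \<noteq> w' \<Longrightarrow> fps_nth w 0 = fps_nth w' 0 \<Longrightarrow>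
      \<exists>\<theta>. fps_nth \<theta> 0 = 0 \<and> \<theta> \<noteq> fps_X \<and> {w, w'} = {fps_const c + fps_X, fps_const c + \<theta>} \<and>
        \<xi> oo \<theta> = \<xi> \<and> (\<forall>f\<in>W - {w, w'}. f oo \<theta> = f)"
proof -
  define \<eta> where "\<eta> = fps_const c + (fps_X :: complex fps)"
  define S where "S = {d. poly P d = poly P c}"
  define q where "q = P - [:poly P c:]"
  have q: "q \<noteq> 0" "degree q = degree P"
  proof -
    have "coeff q (degree P) = lead_coeff P" using P by (simp add: q_def coeff_pCons split: nat.splits)
    then have "coeff q (degree P) \<noteq> 0" using P by auto
    then show "q \<noteq> 0" by auto
    have "degree q \<le> degree P" unfolding q_def by (rule degree_diff_le) simp_all
    then show "degree q = degree P"
      using le_degree[OF \<open>coeff q (degree P) \<noteq> 0\<close>] by (rule le_antisym)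
  qed
  have S: "S = {d. poly q d = 0}" by (auto simp: S_def q_def)
  have finS: "finite S" unfolding S using q poly_roots_finite by blast
  have q': "pderiv q = pderiv P" by (simp add: q_def pderiv_diff pderiv_pCons)
  have P'0: "pderiv P \<noteq> 0" using P by (simp add: pderiv_eq_0_iff)
  have ord1: "order d q = 1" if "d \<in> S" "poly (pderiv P) d \<noteq> 0" for d
    using order_pderiv[OF q(1), of d] that by (simp add: S q' order_0I)
  have \<xi>0: "fps_nth \<xi> 0 = poly P c" by (simp add: \<xi>_def fps_nth_0_poly_const)
  have \<eta>W: "\<eta> \<in> W" by (simp add: W_def \<xi>_def \<eta>_def)
  have W: "finite W" "card W \<le> degree P"
    using fps_roots_bound[OF P] by (simp_all add: W_def)
  have "\<exists>w. w \<in> W \<and> fps_nth w 0 = d" if "d \<in> S" "d \<noteq> c" for d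
  proof -
    have "poly P d = fps_nth \<xi> 0" "poly (pderiv P) d \<noteq> 0" using that other \<xi>0 by (simp_all add: S_def)
    then obtain w where "poly (map_poly fps_const P) w = \<xi>" "fps_nth w 0 = d" by (rule simple_root_series)
    then show ?thesis by (auto simp: W_def)
  qed
  then obtain z where z: "\<And>d. d \<in> S \<Longrightarrow> d \<noteq> c \<Longrightarrow> z d \<in> W \<and> fps_nth (z d) 0 = d" by metis
  \<comment> \<open>One solution for each root of P - P(c), told apart by the constant terms; c is
    represented by \<eta>.\<close>
  define W0 where "W0 = insert \<eta> (z ` (S - {c}))"
  have cS: "c \<in> S" by (simp add: S_def)
  have W0: "W0 \<subseteq> W" using z \<eta>W by (auto simp: W0_def)
  have inj0: "inj_on (\<lambda>w. fps_nth w 0) W0"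
    using z by (auto simp: W0_def inj_on_def \<eta>_def)
  have img0: "(\<lambda>w. fps_nth w 0) ` W0 = S"
    using z cS by (force simp: W0_def \<eta>_def)
  have cardW0: "card W0 = card S" using card_image[OF inj0] img0 by simp
  have "card W = degree P \<and> (\<forall>w\<in>W. \<forall>w'\<in>W. w \<noteq> w' \<longrightarrow> fps_nth w 0 = fps_nth w' 0 \<longrightarrow>
      (\<exists>\<theta>. fps_nth \<theta> 0 = 0 \<and> \<theta> \<noteq> fps_X \<and> {w, w'} = {fps_const c + fps_X, fps_const c + \<theta>} \<and>
        \<xi> oo \<theta> = \<xi> \<and> (\<forall>f\<in>W - {w, w'}. f oo \<theta> = f)))"
  proof (cases "poly (pderiv P) c = 0")
    case False
    have "degree P = (\<Sum>d\<in>S. order d q)" using degree_eq_sum_order[OF q(1)] q S by simp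
    also have "\<dots> = (\<Sum>d\<in>S. 1)"
    proof (intro sum.cong refl ord1)
      show "poly (pderiv P) d \<noteq> 0" if "d \<in> S" for d
        using False other[of d] that by (cases "d = c") (simp_all add: S_def)
    qed
    finally have "card W0 = degree P" using cardW0 by simp
    then have "W0 = W" using card_seteq[OF W(1) W0] W(2) by simp
    then show ?thesis using \<open>card W0 = degree P\<close> inj0 by (auto simp: inj_on_def)
  next
    case True
    have ordc: "order c q = 2"
      using order_pderiv[OF q(1), of c] order_pderiv[OF P'0, of c] True dbl cS by (simp add: S q' order_0I)
    have "degree P = (\<Sum>d\<in>S. order d q)" using degree_eq_sum_order[OF q(1)] q S by simp
    also have "\<dots> = 2 + (\<Sum>d\<in>S - {c}. order d q)" using ordc finS cS by (simp add: sum.remove)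
    also have "(\<Sum>d\<in>S - {c}. order d q) = (\<Sum>d\<in>S - {c}. 1)"
      by (intro sum.cong refl ord1) (use other in \<open>auto simp: S_def\<close>)
    \<comment> \<open>Only c has multiplicity 2, so exactly one solution is missing from
      \<open>W0\<close>, and \<theta>' fills the place.\<close>
    finally have degP: "degree P = Suc (card S)"
      using finS cS card_gt_0_iff[of S] by auto
    obtain \<theta>' where "poly (map_poly fps_const P) \<theta>' = poly (map_poly fps_const P) (fps_const c + fps_X)"
      "fps_nth \<theta>' 0 = c" "\<theta>' \<noteq> fps_const c + fps_X"
      using double_root_series[OF True dbl[OF True]] by blast
    then have \<theta>': "\<theta>' \<in> W" "fps_nth \<theta>' 0 = c" "\<theta>' \<noteq> \<eta>"
      by (simp_all add: W_def \<xi>_def \<eta>_def)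
    have "\<theta>' \<notin> W0"
    proof
      assume "\<theta>' \<in> W0"
      then obtain d where d: "d \<in> S" "d \<noteq> c" "\<theta>' = z d" using \<theta>'(3) unfolding W0_def by blast
      show False using z[OF d(1,2)] \<theta>'(2) d by simp
    qed
    have finW0: "finite W0" by (rule finite_subset[OF W0 W(1)])
    have "card (insert \<theta>' W0) = degree P"
      using \<open>\<theta>' \<notin> W0\<close> finW0 cardW0 degP by simp
    then have WW: "insert \<theta>' W0 = W" using card_seteq[OF W(1), of "insert \<theta>' W0"] W(2) W0 \<theta>'(1) by simp
    define \<theta> where "\<theta> = \<theta>' - fps_const c"
    have \<theta>'_eq: "\<theta>' = fps_const c + \<theta>" by (simp add: \<theta>_def)
    have \<theta>: "fps_nth \<theta> 0 = 0" "\<theta> \<noteq> fps_X"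
      using \<theta>'(2,3) unfolding \<theta>'_eq \<eta>_def by auto
    have \<eta>\<theta>: "\<eta> oo \<theta> = \<theta>'"
      unfolding \<theta>'_eq \<eta>_def fps_compose_add_distrib by (simp add: \<theta>(1))
    have \<xi>\<theta>: "\<xi> oo \<theta> = \<xi>"
    proof -
      have "\<xi> oo \<theta> = poly (map_poly fps_const P) (\<eta> oo \<theta>)"
        unfolding \<xi>_def \<eta>_def by (rule fps_compose_poly_const[OF \<theta>(1)])
      also have "\<dots> = \<xi>" unfolding \<eta>\<theta> using \<theta>'(1) by (simp add: W_def)
      finally show ?thesis .
    qed
    have uniq: "w = w'" if "w \<in> W" "w' \<in> W" "fps_nth w 0 = fps_nth w' 0" "fps_nth w 0 \<noteq> c" for w w'
    proof -
      have "w \<in> W0" "w' \<in> W0" using that \<theta>'(2) WW by auto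
      then show ?thesis using inj0 that(3) by (simp add: inj_on_def)
    qed
    have nonc: "fps_nth w 0 \<noteq> c" if w: "w \<in> W - {\<eta>, \<theta>'}" for w
    proof -
      have "w \<in> z ` (S - {c})" using w unfolding WW[symmetric] W0_def by simp
      then obtain d where d: "d \<in> S" "d \<noteq> c" "w = z d" by blast
      show ?thesis using z[OF d(1,2)] d by simp
    qed
    \<comment> \<open>Since \<theta> fixes \<xi>, it maps solutions to solutions and keeps constant
      terms; away from c the constant term determines the solution.\<close>
    have fixed: "f oo \<theta> = f" if "f \<in> W - {\<eta>, \<theta>'}" for f
    proof (rule uniq)
      have "poly (map_poly fps_const P) (f oo \<theta>) = poly (map_poly fps_const P) f oo \<theta>"
        by (simp add: fps_compose_poly_const[OF \<theta>(1)])
      then show "f oo \<theta> \<in> W" using that \<xi>\<theta> by (simp add: W_def)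
      show "f \<in> W" using that by simp
      show "fps_nth (f oo \<theta>) 0 = fps_nth f 0" "fps_nth (f oo \<theta>) 0 \<noteq> c"
        using nonc[OF that] by simp_all
    qed
    have special: "w = \<eta> \<or> w = \<theta>'" if "w \<in> W" "fps_nth w 0 = c" for w
      using nonc[of w] that by (cases "w = \<eta>"; cases "w = \<theta>'") simp_all
    have pair: "{w, w'} = {\<eta>, \<theta>'}" if ww: "w \<in> W" "w' \<in> W" "w \<noteq> w'" "fps_nth w 0 = fps_nth w' 0" for w w'
    proof -
      have "fps_nth w 0 = c" using uniq[OF ww(1,2,4)] ww(3) by argo
      then have "w = \<eta> \<or> w = \<theta>'" "w' = \<eta> \<or> w' = \<theta>'" using special ww(1,2,4) by simp_all
      then show ?thesis using ww(3) by (elim disjE) (simp_all add: insert_commute)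
    qed
    have "\<exists>\<theta>. fps_nth \<theta> 0 = 0 \<and> \<theta> \<noteq> fps_X \<and> {w, w'} = {fps_const c + fps_X, fps_const c + \<theta>} \<and>
        \<xi> oo \<theta> = \<xi> \<and> (\<forall>f\<in>W - {w, w'}. f oo \<theta> = f)"
      if "w \<in> W" "w' \<in> W" "w \<noteq> w'" "fps_nth w 0 = fps_nth w' 0" for w w'
      unfolding pair[OF that] \<eta>_def[symmetric]
    proof (intro exI[of _ \<theta>] conjI ballI)
      show "{\<eta>, \<theta>'} = {\<eta>, fps_const c + \<theta>}" by (simp only: \<theta>'_eq)
    qed (rule \<theta> \<xi>\<theta> fixed; assumption?)+
    then show ?thesis using \<open>card (insert \<theta>' W0) = degree P\<close> unfolding WW by simp
  qed
  note main = this
  show "card W = degree P" using main by (rule conjunct1)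
  show "\<exists>\<theta>. fps_nth \<theta> 0 = 0 \<and> \<theta> \<noteq> fps_X \<and> {w, w'} = {fps_const c + fps_X, fps_const c + \<theta>} \<and>
        \<xi> oo \<theta> = \<xi> \<and> (\<forall>f\<in>W - {w, w'}. f oo \<theta> = f)"
    if "w \<in> W" "w' \<in> W" "w \<noteq> w'" "fps_nth w 0 = fps_nth w' 0" for w w'
    by (rule main[THEN conjunct2, rule_format, OF that])
qed

section \<open>Transpositions at critical values\<close>

text \<open>The elements of the Galois group: a field homomorphism is injective, and
  \<open>alg_closure_endo_surj\<close> supplies surjectivity.\<close>

definition base_aut :: "('a::field alg_closure \<Rightarrow> 'a alg_closure) \<Rightarrow> bool" where
  "base_aut \<sigma> \<longleftrightarrow> field_hom \<sigma> \<and> (\<forall>a. \<sigma> (to_ac a) = to_ac a)"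

lemma base_aut_bij: "base_aut \<sigma> \<Longrightarrow> bij \<sigma>"
proof -
  assume s: "base_aut \<sigma>"
  then interpret field_hom \<sigma> by (simp add: base_aut_def)
  have "surj \<sigma>" using s alg_closure_endo_surj by (auto simp: base_aut_def)
  then show "bij \<sigma>" by (simp add: bij_def inj_def)
qed

lemma base_aut_comp: "base_aut \<sigma> \<Longrightarrow> base_aut \<tau> \<Longrightarrow> base_aut (\<lambda>x. \<sigma> (\<tau> x))"
proof -
  assume st: "base_aut \<sigma>" "base_aut \<tau>"
  interpret s: field_hom \<sigma> using st by (simp add: base_aut_def)
  interpret t: field_hom \<tau> using st by (simp add: base_aut_def)
  have "field_hom (\<lambda>x. \<sigma> (\<tau> x))"
    by unfold_locales (simp_all add: s.hom_add t.hom_add s.hom_mult t.hom_mult)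
  then show ?thesis using st by (simp add: base_aut_def)
qed

lemma base_aut_inv: "base_aut \<sigma> \<Longrightarrow> base_aut (inv_into UNIV \<sigma>)"
proof -
  assume s: "base_aut \<sigma>"
  interpret s: field_hom \<sigma> using s by (simp add: base_aut_def)
  have b: "bij \<sigma>" by (rule base_aut_bij[OF s])
  have eq: "inv_into UNIV \<sigma> x = y" if "\<sigma> y = x" for x y using that b by (metis bij_inv_eq_iff)
  have r: "\<sigma> (inv_into UNIV \<sigma> x) = x" for x using b by (simp add: bij_is_surj surj_f_inv_f)
  have "field_hom (inv_into UNIV \<sigma>)"
    by unfold_locales (auto intro!: eq simp: s.hom_add s.hom_mult r)
  moreover have "inv_into UNIV \<sigma> (to_ac a) = to_ac a" for a using s by (intro eq) (simp add: base_aut_def)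
  ultimately show ?thesis by (simp add: base_aut_def)
qed

lemma base_aut_fiber:
  assumes "base_aut \<sigma>" "z \<in> fiber P"
  shows "\<sigma> z \<in> fiber P"
proof -
  interpret field_hom \<sigma> using assms by (simp add: base_aut_def)
  have "map_poly \<sigma> (map_poly fun_const P) = map_poly fun_const P"
  proof (rule poly_eqI)
    interpret c: field_hom fun_const by (rule fun_const_hom)
    show "coeff (map_poly \<sigma> (map_poly fun_const P)) i = coeff (map_poly fun_const P) i" for i
      using assms by (simp add: base_aut_def fun_const_def[of "coeff P i"])
  qed
  then have "poly (map_poly fun_const P) (\<sigma> z) = \<sigma> (poly (map_poly fun_const P) z)"
    by (metis poly_map_poly)
  also have "\<dots> = fun_x" using assms by (simp add: fiber_def base_aut_def fun_x_def)
  finally show ?thesis by (simp add: fiber_def)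
qed

definition exchange :: "complex poly \<Rightarrow> algfun \<Rightarrow> algfun \<Rightarrow> bool" where
  "exchange P y z \<longleftrightarrow> (\<exists>\<sigma>. base_aut \<sigma> \<and> \<sigma> y = z \<and> \<sigma> z = y \<and> (\<forall>u\<in>fiber P - {y, z}. \<sigma> u = u))"

lemma exchange_sym: "exchange P y z \<Longrightarrow> exchange P z y"
  unfolding exchange_def by (metis insert_commute)

text \<open>The conjugate of a transposition is a transposition. This is what makes the set of
  unexchanged pairs stable under the Galois group.\<close>

lemma exchange_conj:
  assumes t: "base_aut \<tau>" and e: "exchange P y z"
  shows "exchange P (\<tau> y) (\<tau> z)"
proof -
  obtain \<sigma> where s: "base_aut \<sigma>" "\<sigma> y = z" "\<sigma> z = y" "\<And>u. u \<in> fiber P - {y, z} \<Longrightarrow> \<sigma> u = u"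
    using e by (auto simp: exchange_def)
  have b: "bij \<tau>" by (rule base_aut_bij[OF t])
  then have l: "inv_into UNIV \<tau> (\<tau> x) = x" and r: "\<tau> (inv_into UNIV \<tau> x) = x" for x
    by (simp_all add: bij_is_inj bij_is_surj surj_f_inv_f)
  have "base_aut (\<lambda>x. \<tau> (\<sigma> (inv_into UNIV \<tau> x)))"
    by (rule base_aut_comp[OF t base_aut_comp[OF s(1) base_aut_inv[OF t]]])
  moreover have "\<tau> (\<sigma> (inv_into UNIV \<tau> u)) = u" if u: "u \<in> fiber P - {\<tau> y, \<tau> z}" for u
  proof -
    have "inv_into UNIV \<tau> u \<in> fiber P" using base_aut_fiber[OF base_aut_inv[OF t]] u by simp
    moreover have "inv_into UNIV \<tau> u \<noteq> y" "inv_into UNIV \<tau> u \<noteq> z" using u r[of u] by auto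
    ultimately have "\<sigma> (inv_into UNIV \<tau> u) = inv_into UNIV \<tau> u" using s(4) by simp
    then show ?thesis by (simp add: r)
  qed
  ultimately show ?thesis unfolding exchange_def by (intro exI[of _ "\<lambda>x. \<tau> (\<sigma> (inv_into UNIV \<tau> x))"]) (simp add: l s)
qed

section \<open>From colliding series to transpositions\<close>

definition morse :: "complex poly \<Rightarrow> bool" where
  "morse P \<longleftrightarrow> (\<forall>c. poly (pderiv P) c = 0 \<longrightarrow> poly (pderiv (pderiv P)) c \<noteq> 0) \<and>
     (\<forall>c d. poly (pderiv P) c = 0 \<longrightarrow> poly (pderiv P) d = 0 \<longrightarrow> poly P c = poly P d \<longrightarrow> c = d)"

text \<open>Provides characteristic 0 for the rational functions, as required by the separability
  argument in \<open>automorphism_moving\<close>.\<close>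

instance fract :: ("{idom, ring_char_0}") field_char_0
proof
  show "inj (of_nat :: nat \<Rightarrow> 'a fract)"
    by (rule injI) (simp add: of_nat_fract eq_fract)
qed

text \<open>The quotients of power series invariant under \<open>t \<mapsto> \<theta>(t)\<close> form a field that contains all the
  solutions but \<open>z\<close> and \<open>z'\<close>. It does not contain \<open>z\<close>, so some automorphism over it moves \<open>z\<close>, and
  can only swap \<open>z\<close> and \<open>z'\<close>.\<close>

lemma exchange_of_symmetric_series:
  assumes Phi: "field_hom \<Phi>" and base: "\<And>r. \<exists>a b. b \<noteq> 0 \<and> a oo \<theta> = a \<and> b oo \<theta> = b \<and> \<Phi> (to_ac r) * ser b = ser a"
    and \<theta>: "fps_nth \<theta> 0 = 0" "\<theta> \<noteq> fps_X"
    and z: "z \<in> fiber P" "z' \<in> fiber P" "z \<noteq> z'" "\<Phi> z = ser (fps_const c + fps_X)"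
    and others: "\<And>u. u \<in> fiber P - {z, z'} \<Longrightarrow> \<exists>f. \<Phi> u = ser f \<and> f oo \<theta> = f"
  shows "exchange P z z'"
proof -
  interpret p: field_hom \<Phi> by fact
  interpret s: idom_hom ser by (rule ser_hom)
  have ser0: "b \<noteq> 0 \<Longrightarrow> ser b \<noteq> 0" for b :: "complex fps"
    by (simp add: ser_def)
  \<comment> \<open>Fractions are written in cross-multiplied form because the substitution of
    \<theta> is available on power series only.\<close>
  define K where "K = {u. \<exists>a b. b \<noteq> 0 \<and> a oo \<theta> = a \<and> b oo \<theta> = b \<and> \<Phi> u * ser b = ser a}"
  have KI: "u \<in> K" if "b \<noteq> 0" "a oo \<theta> = a" "b oo \<theta> = b" "\<Phi> u * ser b = ser a" for u a b
    using that by (auto simp: K_def)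
  have sub: "subring_set K"
    unfolding subring_set_def
  proof (intro conjI ballI)
    show "1 \<in> K" by (rule KI[of 1 1]) simp_all
    fix x y assume "x \<in> K" "y \<in> K"
    then obtain a b a' b' where ab: "b \<noteq> 0" "a oo \<theta> = a" "b oo \<theta> = b" "\<Phi> x * ser b = ser a"
      and ab': "b' \<noteq> 0" "a' oo \<theta> = a'" "b' oo \<theta> = b'" "\<Phi> y * ser b' = ser a'"
      by (auto simp: K_def)
    note comp = fps_compose_mult_distrib[OF \<theta>(1)] fps_compose_sub_distrib
    show "x - y \<in> K"
    proof (rule KI[of "b * b'" "a * b' - a' * b"])
      have "\<Phi> (x - y) * ser (b * b') = (\<Phi> x * ser b) * ser b' - (\<Phi> y * ser b') * ser b"
        by (simp add: p.hom_minus s.hom_mult algebra_simps)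
      also have "\<dots> = ser (a * b' - a' * b)" unfolding ab ab' by (simp add: s.hom_mult s.hom_minus)
      finally show "\<Phi> (x - y) * ser (b * b') = ser (a * b' - a' * b)" .
    qed (simp_all add: ab ab' comp)
    show "x * y \<in> K"
    proof (rule KI[of "b * b'" "a * a'"])
      have "\<Phi> (x * y) * ser (b * b') = (\<Phi> x * ser b) * (\<Phi> y * ser b')"
        by (simp add: p.hom_mult s.hom_mult algebra_simps)
      also have "\<dots> = ser (a * a')" unfolding ab ab' by (simp add: s.hom_mult)
      finally show "\<Phi> (x * y) * ser (b * b') = ser (a * a')" .
    qed (simp_all add: ab ab' comp)
  qed
  have baseK: "range to_ac \<subseteq> K" using base by (auto simp: K_def)
  \<comment> \<open>If c + t were a quotient of \<theta>-invariant series, substituting \<theta>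
    would give the same quotient for c + \<theta>, against \<theta> being different from t.\<close>
  have "z \<notin> K"
  proof
    assume "z \<in> K"
    then obtain a b where ab: "b \<noteq> 0" "a oo \<theta> = a" "b oo \<theta> = b" "\<Phi> z * ser b = ser a"
      by (auto simp: K_def)
    have "ser ((fps_const c + fps_X) * b) = ser a" using ab(4) z(4) by (simp add: s.hom_mult)
    then have e1: "(fps_const c + fps_X) * b = a" by simp
    then have "((fps_const c + fps_X) * b) oo \<theta> = a" using ab(2) by simp
    then have "(fps_const c + \<theta>) * b = a"
      by (simp add: fps_compose_mult_distrib[OF \<theta>(1)] fps_compose_add_distrib \<theta>(1) ab(3))
    with e1 have "(fps_const c + \<theta>) * b = (fps_const c + fps_X) * b" by (simp only:)
    then have "fps_const c + \<theta> = fps_const c + fps_X" using ab(1) by (simp only: mult_cancel_right simp_thms)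
    then show False using \<theta>(2) by simp
  qed
  then obtain \<sigma> where \<sigma>: "field_hom \<sigma>" "\<And>u. u \<in> K \<Longrightarrow> \<sigma> u = u" "\<sigma> z \<noteq> z"
    using automorphism_moving[OF sub baseK] by blast
  have aut: "base_aut \<sigma>" using \<sigma>(1,2) baseK by (auto simp: base_aut_def)
  have fixed: "\<sigma> u = u" if u: "u \<in> fiber P - {z, z'}" for u
  proof -
    obtain f where f: "\<Phi> u = ser f" "f oo \<theta> = f" using others[OF u] by blast
    have "u \<in> K" by (rule KI[of 1 f]) (simp_all add: f)
    then show ?thesis by (rule \<sigma>(2))
  qed
  have inj: "\<sigma> u = \<sigma> v \<longleftrightarrow> u = v" for u v using base_aut_bij[OF aut] by (simp add: bij_is_inj inj_eq)
  have "\<sigma> z \<in> fiber P" "\<sigma> z' \<in> fiber P" using base_aut_fiber[OF aut] z by simp_all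
  \<comment> \<open>Any other solution distinct from \<open>z\<close> is fixed by \<sigma>, so
    having it as the image of \<open>z\<close> would contradict injectivity.\<close>
  have "\<sigma> z = z'"
  proof (rule ccontr)
    assume "\<sigma> z \<noteq> z'"
    then have "\<sigma> (\<sigma> z) = \<sigma> z" using fixed \<sigma>(3) \<open>\<sigma> z \<in> fiber P\<close> by simp
    then show False using inj \<sigma>(3) by simp
  qed
  moreover have "\<sigma> z' = z"
  proof (rule ccontr)
    assume "\<sigma> z' \<noteq> z"
    moreover have "\<sigma> z' \<noteq> z'" using \<open>\<sigma> z = z'\<close> inj[of z z'] z(3) by simp
    ultimately have "\<sigma> (\<sigma> z') = \<sigma> z'" using fixed \<open>\<sigma> z' \<in> fiber P\<close> by simp
    then show False using inj \<open>\<sigma> z' \<noteq> z'\<close> by simp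
  qed
  ultimately show ?thesis using aut fixed unfolding exchange_def by (intro exI[of _ \<sigma>]) simp
qed

text \<open>The expansion P(c + t) with P(c) = v centres the place over v.
  \<open>fiber_series\<close> supplies degree-many power series solutions, which therefore exhaust
  the images of the fiber, and each collision between them supplies a symmetric
  substitution.\<close>

lemma finite_place:
  assumes P: "degree P > 0" and "morse P"
  obtains \<Phi> :: "algfun \<Rightarrow> complex fls alg_closure" and \<xi>
  where "field_hom \<Phi>" "fps_nth \<xi> 0 = v" "card (fiber P) = degree P"
    "\<And>a b. b \<noteq> 0 \<Longrightarrow> \<Phi> (to_ac (Fract a b)) * ser (poly (map_poly fps_const b) \<xi>) = ser (poly (map_poly fps_const a) \<xi>)"
    "\<And>z. z \<in> fiber P \<Longrightarrow> \<exists>w. \<Phi> z = ser w"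
    "\<And>z z' w w'. z \<in> fiber P \<Longrightarrow> z' \<in> fiber P \<Longrightarrow> z \<noteq> z' \<Longrightarrow> \<Phi> z = ser w \<Longrightarrow> \<Phi> z' = ser w' \<Longrightarrow>
      fps_nth w 0 = fps_nth w' 0 \<Longrightarrow> exchange P z z'"
proof -
  have m1: "poly (pderiv P) c = 0 \<Longrightarrow> poly (pderiv (pderiv P)) c \<noteq> 0" for c
    using \<open>morse P\<close> by (simp add: morse_def)
  have m2: "poly (pderiv P) c = 0 \<Longrightarrow> poly (pderiv P) d = 0 \<Longrightarrow> poly P c = poly P d \<Longrightarrow> c = d" for c d
    using \<open>morse P\<close> by (simp add: morse_def)
  \<comment> \<open>A critical point over v is taken if there is one, and distinct critical values
    make it the only one; otherwise any root of P - v serves.\<close>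
  obtain c where c: "poly P c = v" and other: "\<And>d. d \<noteq> c \<Longrightarrow> poly P d = poly P c \<Longrightarrow> poly (pderiv P) d \<noteq> 0"
  proof (cases "\<exists>c. poly P c = v \<and> poly (pderiv P) c = 0")
    case True
    then obtain c where c: "poly P c = v" "poly (pderiv P) c = 0" by blast
    show ?thesis by (rule that[OF c(1)]) (use m2 c(2) in auto)
  next
    case False
    have "degree (P - [:v:]) > 0"
    proof (rule ccontr)
      assume "\<not> degree (P - [:v:]) > 0"
      then obtain k where "P - [:v:] = [:k:]" by (auto elim: degree_eq_zeroE)
      then have "P = [:k + v:]" by (simp add: diff_eq_eq)
      then show False using P by simp
    qed
    then obtain c where "poly (P - [:v:]) c = 0" using alg_closed_imp_poly_has_root by blast
    then have c: "poly P c = v" by simp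
    show ?thesis by (rule that[OF c]) (use False c in auto)
  qed
  define \<xi> where "\<xi> = poly (map_poly fps_const P) (fps_const c + fps_X)"
  define W where "W = {w. poly (map_poly fps_const P) w = \<xi>}"
  have cardW: "card W = degree P"
    and coll: "\<And>w w'. w \<in> W \<Longrightarrow> w' \<in> W \<Longrightarrow> w \<noteq> w' \<Longrightarrow> fps_nth w 0 = fps_nth w' 0 \<Longrightarrow>
      \<exists>\<theta>. fps_nth \<theta> 0 = 0 \<and> \<theta> \<noteq> fps_X \<and> {w, w'} = {fps_const c + fps_X, fps_const c + \<theta>} \<and>
        \<xi> oo \<theta> = \<xi> \<and> (\<forall>f\<in>W - {w, w'}. f oo \<theta> = f)"
    using fiber_series[OF P other m1] unfolding W_def \<xi>_def by simp_all
  interpret s: idom_hom ser by (rule ser_hom)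
  interpret fl: comm_ring_hom "fps_to_fls :: complex fps \<Rightarrow> _"
    by unfold_locales (simp_all add: fls_times_fps_to_fls)
  have to_fls: "poly (map_poly fls_const p) (fps_to_fls f) = fps_to_fls (poly (map_poly fps_const p) f)"
    for p :: "complex poly" and f
  proof -
    have "map_poly fls_const p = map_poly fps_to_fls (map_poly fps_const p)"
      by (simp add: poly_eq_iff coeff_map_poly)
    then show ?thesis by (simp only: fl.poly_map_poly)
  qed
  have "fps_to_fls \<xi> \<notin> range fls_const"
  proof
    assume "fps_to_fls \<xi> \<in> range fls_const"
    then obtain k where "fps_to_fls \<xi> = fls_const k" by blast
    then have "fps_to_fls \<xi> = fps_to_fls (fps_const k)" by simp
    then have "\<xi> = fps_const k" by (simp only: fps_to_fls_eq_iff)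
    then have "poly (map_poly fps_const (P - [:k:])) (fps_const c + fps_X) = 0"
    proof -
      interpret i: idom_hom "fps_const :: complex \<Rightarrow> _" by (rule fps_const_hom)
      interpret mi: map_poly_idom_hom "fps_const :: complex \<Rightarrow> _" ..
      show ?thesis using \<open>\<xi> = fps_const k\<close> by (simp add: mi.hom_minus i.map_poly_pCons_hom \<xi>_def)
    qed
    then have "P - [:k:] = 0" by (rule poly_fps_const_plus_X_eq_0)
    then show False using P by simp
  qed
  then obtain \<Phi> where pl: "place \<Phi> (fps_to_fls \<xi>)" by (rule place_exists)
  note \<Phi> = placeD[OF pl]
  interpret p: field_hom \<Phi> by (rule \<Phi>(1))
  have frac: "poly (map_poly fps_const b) \<xi> \<noteq> 0"
    "\<Phi> (to_ac (Fract a b)) * ser (poly (map_poly fps_const b) \<xi>) = ser (poly (map_poly fps_const a) \<xi>)"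
    if "b \<noteq> 0" for a b
    using \<Phi>(4)[OF that] by (simp_all add: \<Phi>(5)[OF that] to_fls ser_def)
  have img: "\<Phi> ` fiber P = {w. poly (map_poly (\<lambda>c. ser (fps_const c)) P) w = ser \<xi>}"
    using fiber_image[OF pl P] by (simp add: ser_def)
  have "ser ` W \<subseteq> \<Phi> ` fiber P" unfolding img by (auto simp: W_def ser_poly)
  have card_le: "card (\<Phi> ` fiber P) \<le> degree P"
  proof -
    define q where "q = map_poly (\<lambda>c. ser (fps_const c)) P - [:ser \<xi>:]"
    have "coeff q (degree P) = ser (fps_const (lead_coeff P))"
      using P by (simp add: q_def coeff_pCons coeff_map_poly split: nat.splits)
    moreover have "ser (fps_const (lead_coeff P)) \<noteq> 0" using P by (auto simp: ser_def)
    ultimately have "q \<noteq> 0" by auto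
    have "degree q \<le> degree P" unfolding q_def by (rule degree_diff_le) (simp_all add: degree_map_poly_le)
    moreover have "\<Phi> ` fiber P = {w. poly q w = 0}" unfolding img by (auto simp: q_def)
    ultimately show ?thesis using card_poly_roots_bound[OF \<open>q \<noteq> 0\<close>] by simp
  qed
  have inj: "inj_on \<Phi> (fiber P)" by (auto simp: inj_on_def)
  have "card (ser ` W) = degree P" using cardW by (simp add: card_image inj_on_def)
  then have imgW: "\<Phi> ` fiber P = ser ` W"
    using card_seteq[OF finite_imageI[OF finite_fiber[OF P]] \<open>ser ` W \<subseteq> \<Phi> ` fiber P\<close>] card_le by simp
  have cardf: "card (fiber P) = degree P"
    using card_image[OF inj] imgW \<open>card (ser ` W) = degree P\<close> by simp
  have exch: "exchange P z z'"
    if z: "z \<in> fiber P" "z' \<in> fiber P" "z \<noteq> z'" "\<Phi> z = ser w" "\<Phi> z' = ser w'"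
      and col: "fps_nth w 0 = fps_nth w' 0" for z z' w w'
  proof -
    have "ser w \<in> ser ` W" "ser w' \<in> ser ` W" using z imgW by (metis imageI)+
    then have W: "w \<in> W" "w' \<in> W" by auto
    have injD: "u = u'" if "\<Phi> u = \<Phi> u'" for u u' using that by simp
    have "w \<noteq> w'" using z injD[of z z'] by auto
    obtain \<theta> where th: "fps_nth \<theta> 0 = 0 \<and> \<theta> \<noteq> fps_X \<and> {w, w'} = {fps_const c + fps_X, fps_const c + \<theta>} \<and>
        \<xi> oo \<theta> = \<xi> \<and> (\<forall>f\<in>W - {w, w'}. f oo \<theta> = f)"
      using coll[OF W \<open>w \<noteq> w'\<close> col] by (elim exE)
    note th2 = th[THEN conjunct2] note th3 = th2[THEN conjunct2] note th4 = th3[THEN conjunct2]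
    note \<theta> = th[THEN conjunct1] th2[THEN conjunct1] th3[THEN conjunct1] th4[THEN conjunct1]
    note \<theta>_fix = bspec[OF th4[THEN conjunct2]]
    have base: "\<exists>a b. b \<noteq> 0 \<and> a oo \<theta> = a \<and> b oo \<theta> = b \<and> \<Phi> (to_ac r) * ser b = ser a" for r
    proof -
      obtain a b where ab: "r = Fract a b" "b \<noteq> 0" by (cases r) auto
      then show ?thesis
        using frac[OF ab(2)] by (intro exI[of _ "poly (map_poly fps_const a) \<xi>"] exI[of _ "poly (map_poly fps_const b) \<xi>"])
          (simp add: fps_compose_poly_const[OF \<theta>(1)] \<theta>(4))
    qed
    have others: "\<exists>f. \<Phi> u = ser f \<and> f oo \<theta> = f" if u: "u \<in> fiber P - {z, z'}" for u
    proof -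
      have "\<Phi> u \<in> ser ` W" using u imgW by blast
      then obtain f where f: "\<Phi> u = ser f" "f \<in> W" by blast
      have "f \<noteq> w" "f \<noteq> w'" using f(1) u z injD[of u z] injD[of u z'] by auto
      then show ?thesis using f \<theta>_fix[of f] by auto
    qed
    \<comment> \<open>The colliding pair is known only as an unordered pair, so either solution may
      be the one that expands as c + t; symmetry of \<open>exchange\<close> covers both
      cases.\<close>
    have "w = p \<or> w' = p" if "{w, w'} = {p, q}" for p q using that by (auto simp: doubleton_eq_iff)
    note this[OF \<theta>(3)]
    then show ?thesis
    proof
      assume "w = fps_const c + fps_X"
      then show ?thesis
        using exchange_of_symmetric_series[OF \<Phi>(1) base \<theta>(1,2) z(1-3) _ others] z(4) by simp
    next
      assume "w' = fps_const c + fps_X"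
      then have "exchange P z' z"
        using exchange_of_symmetric_series[OF \<Phi>(1) base \<theta>(1,2) z(2,1) z(3)[symmetric] _ others] z(5)
        by (simp add: insert_commute)
      then show ?thesis by (rule exchange_sym)
    qed
  qed
  have "\<exists>w. \<Phi> z = ser w" if "z \<in> fiber P" for z using that imgW by blast
  moreover have "fps_nth \<xi> 0 = v" by (simp add: \<xi>_def fps_nth_0_poly_const c)
  ultimately show ?thesis using that[OF \<Phi>(1) _ cardf frac(2) _ exch] by simp
qed

section \<open>All pairs of solutions are exchanged\<close>

text \<open>Ordered pairs, so that an automorphism permutes the factors of the product of
  differences without any change of sign.\<close>

definition rigid_pairs :: "complex poly \<Rightarrow> (algfun \<times> algfun) set" where
  "rigid_pairs P = {(y, z). y \<in> fiber P \<and> z \<in> fiber P \<and> y \<noteq> z \<and> \<not> exchange P y z}"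

lemma finite_rigid_pairs: "degree P > 0 \<Longrightarrow> finite (rigid_pairs P)"
  by (rule finite_subset[of _ "fiber P \<times> fiber P"]) (auto simp: rigid_pairs_def finite_fiber)

lemma base_aut_rigid_pairs:
  assumes s: "base_aut \<sigma>"
  shows "bij_betw (map_prod \<sigma> \<sigma>) (rigid_pairs P) (rigid_pairs P)"
proof -
  have b: "bij \<sigma>" by (rule base_aut_bij[OF s])
  then have inj: "\<sigma> x = \<sigma> y \<longleftrightarrow> x = y" for x y by (simp add: bij_is_inj inj_eq)
  have step: "(\<tau> y, \<tau> z) \<in> rigid_pairs P" if t: "base_aut \<tau>" and yz: "(y, z) \<in> rigid_pairs P" for \<tau> y z
  proof -
    have bt: "bij \<tau>" by (rule base_aut_bij[OF t])
    have "\<not> exchange P (\<tau> y) (\<tau> z)"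
    proof
      assume "exchange P (\<tau> y) (\<tau> z)"
      then have "exchange P (inv_into UNIV \<tau> (\<tau> y)) (inv_into UNIV \<tau> (\<tau> z))"
        by (rule exchange_conj[OF base_aut_inv[OF t]])
      then have "exchange P y z" using bt by (simp add: bij_is_inj)
      then show False using yz by (simp add: rigid_pairs_def)
    qed
    moreover have "\<tau> y \<noteq> \<tau> z" using yz bt by (simp add: rigid_pairs_def bij_is_inj inj_eq)
    ultimately show ?thesis using yz base_aut_fiber[OF t] by (simp add: rigid_pairs_def)
  qed
  show ?thesis
  proof (rule bij_betwI')
    show "map_prod \<sigma> \<sigma> p = map_prod \<sigma> \<sigma> q \<longleftrightarrow> p = q" for p q
      by (cases p; cases q) (simp add: inj)
    show "map_prod \<sigma> \<sigma> p \<in> rigid_pairs P" if "p \<in> rigid_pairs P" for p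
      using that step[OF s] by (cases p) simp
    show "\<exists>q\<in>rigid_pairs P. p = map_prod \<sigma> \<sigma> q" if "p \<in> rigid_pairs P" for p
    proof
      have r: "\<sigma> (inv_into UNIV \<sigma> x) = x" for x using b by (simp add: bij_is_surj surj_f_inv_f)
      let ?q = "map_prod (inv_into UNIV \<sigma>) (inv_into UNIV \<sigma>) p"
      show "p = map_prod \<sigma> \<sigma> ?q" by (cases p) (simp add: r)
      show "?q \<in> rigid_pairs P" using that step[OF base_aut_inv[OF s]] by (cases p) simp
    qed
  qed
qed

definition rigid_disc :: "complex poly \<Rightarrow> algfun" where
  "rigid_disc P = (\<Prod>(y, z)\<in>rigid_pairs P. y - z)"

lemma rigid_disc_rational: "rigid_disc P \<in> range to_ac"
proof (rule ccontr)
  assume n: "rigid_disc P \<notin> range to_ac"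
  have "subring_set (range to_ac :: algfun set)"
    unfolding subring_set_def
    by (auto simp flip: to_ac_diff to_ac_mult to_ac_1 simp del: to_ac_diff to_ac_mult to_ac_1)
  then obtain \<sigma> :: "algfun \<Rightarrow> algfun" where s: "field_hom \<sigma>" "\<And>u. u \<in> range to_ac \<Longrightarrow> \<sigma> u = u" "\<sigma> (rigid_disc P) \<noteq> rigid_disc P"
    using automorphism_moving[OF _ order.refl n] by metis
  have aut: "base_aut \<sigma>" using s(1,2) by (simp add: base_aut_def)
  interpret s: field_hom \<sigma> by (rule s(1))
  have "\<sigma> (rigid_disc P) = (\<Prod>p\<in>rigid_pairs P. fst (map_prod \<sigma> \<sigma> p) - snd (map_prod \<sigma> \<sigma> p))"
    by (simp add: rigid_disc_def s.hom_prod s.hom_minus case_prod_beta)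
  also have "\<dots> = (\<Prod>p\<in>rigid_pairs P. fst p - snd p)"
    by (rule prod.reindex_bij_betw[OF base_aut_rigid_pairs[OF aut]])
  also have "\<dots> = rigid_disc P" by (simp add: rigid_disc_def case_prod_beta)
  finally show False using s(3) by simp
qed

text \<open>The scaling factor \<open>t\<close> lets one argument serve all places: it is 1 over
  finite points, and the local parameter at infinity, where it cancels the simple poles. Equal
  constant terms would make a pair exchangeable, so each scaled factor is a unit series.\<close>

lemma place_rigid_disc:
  fixes \<Phi> :: "algfun \<Rightarrow> complex fls alg_closure"
  assumes P: "degree P > 0" and Phi: "field_hom \<Phi>"
    and ser: "\<And>z. z \<in> fiber P \<Longrightarrow> \<exists>w. \<Phi> z * t = ser w"
    and sep: "\<And>z z' w w'. z \<in> fiber P \<Longrightarrow> z' \<in> fiber P \<Longrightarrow> z \<noteq> z' \<Longrightarrow> \<Phi> z * t = ser w \<Longrightarrow> \<Phi> z' * t = ser w' \<Longrightarrow>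
      fps_nth w 0 = fps_nth w' 0 \<Longrightarrow> exchange P z z'"
  obtains f where "\<Phi> (rigid_disc P) * t ^ card (rigid_pairs P) = ser f" "fps_nth f 0 \<noteq> 0"
proof -
  interpret p: field_hom \<Phi> by fact
  interpret s: idom_hom ser by (rule ser_hom)
  obtain w where w: "\<And>z. z \<in> fiber P \<Longrightarrow> \<Phi> z * t = ser (w z)" using ser by metis
  define f where "f = (\<Prod>(y, z)\<in>rigid_pairs P. w y - w z)"
  have "\<Phi> (rigid_disc P) * t ^ card (rigid_pairs P) = (\<Prod>p\<in>rigid_pairs P. \<Phi> (fst p - snd p)) * (\<Prod>p\<in>rigid_pairs P. t)"
    by (simp add: rigid_disc_def case_prod_beta p.hom_prod)
  also have "\<dots> = (\<Prod>p\<in>rigid_pairs P. \<Phi> (fst p - snd p) * t)" by (rule prod.distrib[symmetric])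
  also have "\<dots> = (\<Prod>p\<in>rigid_pairs P. ser (w (fst p) - w (snd p)))"
  proof (rule prod.cong[OF refl])
    fix p assume "p \<in> rigid_pairs P"
    then have "fst p \<in> fiber P" "snd p \<in> fiber P" by (auto simp: rigid_pairs_def)
    then show "\<Phi> (fst p - snd p) * t = ser (w (fst p) - w (snd p))"
      using w by (simp add: p.hom_minus s.hom_minus left_diff_distrib)
  qed
  also have "\<dots> = ser f" by (simp add: f_def case_prod_beta s.hom_prod)
  finally have 1: "\<Phi> (rigid_disc P) * t ^ card (rigid_pairs P) = ser f" .
  have "fps_nth f 0 = (\<Prod>p\<in>rigid_pairs P. fps_nth (w (fst p)) 0 - fps_nth (w (snd p)) 0)"
  proof -
    have "fps_nth (prod g A) 0 = (\<Prod>x\<in>A. fps_nth (g x) 0)" for g :: "algfun \<times> algfun \<Rightarrow> complex fps" and A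
      by (induction A rule: infinite_finite_induct) simp_all
    note nth = this
    show ?thesis unfolding f_def case_prod_beta nth by simp
  qed
  moreover have "fps_nth (w (fst p)) 0 - fps_nth (w (snd p)) 0 \<noteq> 0" if "p \<in> rigid_pairs P" for p
  proof -
    have "fst p \<in> fiber P" "snd p \<in> fiber P" "fst p \<noteq> snd p" "\<not> exchange P (fst p) (snd p)"
      using that by (auto simp: rigid_pairs_def)
    then show ?thesis using sep[OF _ _ _ w w] by auto
  qed
  ultimately have "fps_nth f 0 \<noteq> 0" using finite_rigid_pairs[OF P] by simp
  with 1 show ?thesis by (rule that)
qed

text \<open>With a/b written with denominator of least degree, a and b have no common zero. At each
  v they differ by a unit series, so a zero of one would be a zero of both; hence neither has any
  zero and both are constants.\<close>

lemma rigid_disc_const: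
  assumes P: "degree P > 0" "morse P"
  obtains \<gamma> where "rigid_disc P = fun_const \<gamma>"
proof -
  define R where "R = (\<lambda>(a, b). b \<noteq> 0 \<and> rigid_disc P = to_ac (Fract a b))"
  obtain r where r: "rigid_disc P = to_ac r" using rigid_disc_rational by blast
  obtain a0 b0 where "r = Fract a0 b0" "b0 \<noteq> 0" by (cases r) auto
  then have "R (a0, b0)" using r by (simp add: R_def)
  then obtain ab where ab: "R ab" "\<And>cd. R cd \<Longrightarrow> degree (snd ab) \<le> degree (snd cd)"
    using ex_has_least_nat[of R "(a0, b0)" "\<lambda>ab. degree (snd ab)"] by auto
  obtain a b where ab_eq: "ab = (a, b)" by (cases ab)
  have b: "b \<noteq> 0" "rigid_disc P = to_ac (Fract a b)"
    using ab(1) unfolding ab_eq R_def by simp_all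
  have least: "degree b \<le> degree d" if "d \<noteq> 0" "rigid_disc P = to_ac (Fract c d)" for c d
    using ab(2)[of "(c, d)"] that unfolding ab_eq R_def by simp
  have coprime: "\<not> (poly a v = 0 \<and> poly b v = 0)" for v
  proof
    assume "poly a v = 0 \<and> poly b v = 0"
    then obtain c d where cd: "a = [:-v, 1:] * c" "b = [:-v, 1:] * d"
      by (metis dvdE poly_eq_0_iff_dvd)
    have "d \<noteq> 0" using b cd by auto
    have "Fract a b = Fract c d" unfolding cd by (rule mult_fract_cancel) simp
    then have "degree b \<le> degree d" using least[OF \<open>d \<noteq> 0\<close>] b by simp
    moreover have "degree b = Suc (degree d)" unfolding cd using \<open>d \<noteq> 0\<close> by (subst degree_mult_eq) auto
    ultimately show False by simp
  qed
  have nz: "poly a v \<noteq> 0 \<and> poly b v \<noteq> 0" for v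
  proof -
    obtain \<Phi> :: "algfun \<Rightarrow> complex fls alg_closure" and \<xi> where \<Phi>: "field_hom \<Phi>" "fps_nth \<xi> 0 = v"
      and fr: "\<And>a b. b \<noteq> 0 \<Longrightarrow> \<Phi> (to_ac (Fract a b)) * ser (poly (map_poly fps_const b) \<xi>) = ser (poly (map_poly fps_const a) \<xi>)"
      and int: "\<And>z. z \<in> fiber P \<Longrightarrow> \<exists>w. \<Phi> z = ser w"
      and sep: "\<And>z z' w w'. z \<in> fiber P \<Longrightarrow> z' \<in> fiber P \<Longrightarrow> z \<noteq> z' \<Longrightarrow> \<Phi> z = ser w \<Longrightarrow> \<Phi> z' = ser w' \<Longrightarrow>
        fps_nth w 0 = fps_nth w' 0 \<Longrightarrow> exchange P z z'"
      using finite_place[OF P, of v] by blast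
    interpret s: idom_hom ser by (rule ser_hom)
    obtain f where f: "\<Phi> (rigid_disc P) * 1 ^ card (rigid_pairs P) = ser f" "fps_nth f 0 \<noteq> 0"
      by (rule place_rigid_disc[OF P(1) \<Phi>(1), of 1]) (use int sep in simp_all)
    then have "ser (f * poly (map_poly fps_const b) \<xi>) = ser (poly (map_poly fps_const a) \<xi>)"
      using fr[OF b(1), of a] b(2) by (simp add: s.hom_mult)
    then have "f * poly (map_poly fps_const b) \<xi> = poly (map_poly fps_const a) \<xi>" by (simp only: ser_eq_iff)
    then have "fps_nth (f * poly (map_poly fps_const b) \<xi>) 0 = fps_nth (poly (map_poly fps_const a) \<xi>) 0" by simp
    then have "fps_nth f 0 * poly b v = poly a v" by (simp add: fps_nth_0_poly_const \<Phi>(2))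
    then show ?thesis using f(2) coprime[of v] by auto
  qed
  have "degree a = 0" "degree b = 0"
    using nz alg_closed_imp_poly_has_root[of a] alg_closed_imp_poly_has_root[of b] by blast+
  then obtain \<alpha> \<beta> where "a = [:\<alpha>:]" "b = [:\<beta>:]" by (metis degree_eq_zeroE)
  moreover from this have "Fract [:\<alpha>:] [:\<beta>:] = Fract [:\<alpha> / \<beta>:] 1" using b(1) by (simp add: eq_fract)
  ultimately have "rigid_disc P = fun_const (\<alpha> / \<beta>)" using b(2) by (simp add: fun_const_def)
  then show ?thesis by (rule that)
qed

text \<open>At infinity \<open>x = P(1/t)\<close>, and \<open>y = \<lambda>/t\<close> turns the equation into
  \<open>t\<^sup>m P(\<lambda>/t) = t\<^sup>m P(1/t)\<close>, which reduces to \<open>\<lambda>\<^sup>m = 1\<close> modulo \<open>t\<close>.\<close>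

lemma infinite_place:
  assumes P: "degree P > 0" and cardf: "card (fiber P) = degree P"
  obtains \<Phi> :: "algfun \<Rightarrow> complex fls alg_closure"
  where "field_hom \<Phi>" "\<And>c. \<Phi> (fun_const c) = ser (fps_const c)"
    "\<And>z. z \<in> fiber P \<Longrightarrow> \<exists>w. \<Phi> z * ser fps_X = ser w"
    "\<And>z z' w w'. z \<in> fiber P \<Longrightarrow> z' \<in> fiber P \<Longrightarrow> z \<noteq> z' \<Longrightarrow> \<Phi> z * ser fps_X = ser w \<Longrightarrow>
      \<Phi> z' * ser fps_X = ser w' \<Longrightarrow> fps_nth w 0 \<noteq> fps_nth w' 0"
proof -
  define m where "m = degree P"
  \<comment> \<open>\<open>G\<close> at \<open>w\<close> is t^m P(w/t), cleared of denominators so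
    that its coefficients are power series; modulo t only the leading monomial remains.\<close>
  define G where "G = (\<Sum>k\<le>m. Polynomial.monom (fps_const (coeff P k) * fps_X ^ (m - k)) k)"
  define Q where "Q = (\<lambda>y. poly (map_poly fls_const P) (y :: complex fls))"
  interpret fl: idom_hom "fps_to_fls :: complex fps \<Rightarrow> _"
    by unfold_locales (simp_all add: fls_times_fps_to_fls)
  interpret s: idom_hom ser by (rule ser_hom)
  interpret c: field_hom "fls_const :: complex \<Rightarrow> _" by (rule fls_const_hom)
  define t where "t = fps_to_fls (fps_X :: complex fps)"
  have t0: "t \<noteq> 0" by (simp add: t_def)
  have polyG: "poly G w = (\<Sum>k\<le>m. fps_const (coeff P k) * fps_X ^ (m - k) * w ^ k)" for w
    by (simp add: G_def poly_sum poly_monom)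
  have QG: "t ^ m * Q (fps_to_fls w / t) = fps_to_fls (poly G w)" for w
  proof -
    have "Q (fps_to_fls w / t) = (\<Sum>k\<le>m. fls_const (coeff P k) * (fps_to_fls w / t) ^ k)"
      unfolding Q_def poly_altdef by (simp add: m_def)
    then have "t ^ m * Q (fps_to_fls w / t) = (\<Sum>k\<le>m. t ^ m * (fls_const (coeff P k) * (fps_to_fls w / t) ^ k))"
      by (simp add: sum_distrib_left)
    also have "\<dots> = (\<Sum>k\<le>m. fps_to_fls (fps_const (coeff P k) * fps_X ^ (m - k) * w ^ k))"
    proof (rule sum.cong[OF refl])
      fix k assume "k \<in> {..m}"
      then have tm: "t ^ m = t ^ (m - k) * t ^ k" by (simp flip: power_add)
      have eq: "fps_to_fls (fps_const (coeff P k) * fps_X ^ (m - k) * w ^ k) =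
          fls_const (coeff P k) * t ^ (m - k) * fps_to_fls w ^ k"
        unfolding fl.hom_mult fl.hom_power t_def by simp
      show "t ^ m * (fls_const (coeff P k) * (fps_to_fls w / t) ^ k) = fps_to_fls (fps_const (coeff P k) * fps_X ^ (m - k) * w ^ k)"
        unfolding eq tm using t0 by (simp add: power_divide)
    qed
    also have "\<dots> = fps_to_fls (poly G w)" unfolding polyG by (rule fl.hom_sum[symmetric])
    finally show ?thesis .
  qed
  define \<xi> where "\<xi> = Q (1 / t)"
  have Q_iff: "Q (fps_to_fls w / t) = \<xi> \<longleftrightarrow> poly G w = poly G 1" for w
  proof -
    have "Q (fps_to_fls w / t) = \<xi> \<longleftrightarrow> t ^ m * Q (fps_to_fls w / t) = t ^ m * Q (fps_to_fls 1 / t)"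
      using t0 by (simp add: \<xi>_def)
    also have "\<dots> \<longleftrightarrow> poly G w = poly G 1" unfolding QG by (rule fps_to_fls_eq_iff)
    finally show ?thesis .
  qed
  have redG: "map_poly (\<lambda>f. fps_nth f 0) G = Polynomial.monom (lead_coeff P) m"
  proof (rule poly_eqI)
    fix k
    have "coeff G k = (if k \<le> m then fps_const (coeff P k) * fps_X ^ (m - k) else 0)"
      unfolding G_def by (simp add: coeff_sum coeff_monom if_distrib cong: if_cong)
    then show "coeff (map_poly (\<lambda>f. fps_nth f 0) G) k = coeff (Polynomial.monom (lead_coeff P) m) k"
      by (auto simp: coeff_map_poly coeff_monom m_def fps_mult_nth_0 fps_X_power_nth)
  qed
  have G0: "fps_nth (poly G w) 0 = lead_coeff P * fps_nth w 0 ^ m" for w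
    by (simp add: fps_nth_0_poly redG poly_monom)
  interpret r: idom_hom "\<lambda>f :: complex fps. fps_nth f 0" by unfold_locales simp_all
  have G'0: "fps_nth (poly (pderiv G) w) 0 = lead_coeff P * of_nat m * fps_nth w 0 ^ (m - 1)" for w
    by (simp add: fps_nth_0_poly r.map_poly_pderiv redG pderiv_monom poly_monom)
  have m0: "m > 0" "lead_coeff P \<noteq> 0" using P by (auto simp: m_def)
  have "\<xi> \<notin> range fls_const"
  proof
    assume "\<xi> \<in> range fls_const"
    then obtain k where k: "Q (1 / t) = fls_const k" by (auto simp: \<xi>_def)
    have "fps_to_fls (poly G 1) = t ^ m * fls_const k" using QG[of 1] k by simp
    also have "\<dots> = fps_to_fls (fps_X ^ m * fps_const k)" by (simp add: fl.hom_mult fl.hom_power t_def)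
    finally have "poly G 1 = fps_X ^ m * fps_const k" by (simp only: fps_to_fls_eq_iff)
    then have "fps_nth (poly G 1) 0 = 0" using m0 by simp
    then show False using m0 by (simp add: G0)
  qed
  then obtain \<Phi> where pl: "place \<Phi> \<xi>" by (rule place_exists)
  note \<Phi> = placeD[OF pl]
  interpret p: field_hom \<Phi> by (rule \<Phi>(1))
  define U where "U = {\<zeta> :: complex. \<zeta> ^ m = 1}"
  have "\<exists>w. poly G w = poly G 1 \<and> fps_nth w 0 = \<zeta>" if "\<zeta> \<in> U" for \<zeta>
  proof -
    have \<zeta>: "\<zeta> ^ m = 1" using that by (simp add: U_def)
    then have "\<zeta> \<noteq> 0" using m0 by (auto simp: power_0_left)
    define p where "p = G - [:poly G 1:]"
    have "fps_nth (poly p (fps_const \<zeta>)) 0 = 0" using \<zeta> by (simp add: p_def G0)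
    moreover have "fps_nth (poly (pderiv p) (fps_const \<zeta>)) 0 \<noteq> 0"
      using m0 \<open>\<zeta> \<noteq> 0\<close> by (simp add: p_def pderiv_diff pderiv_pCons G'0)
    ultimately obtain w where "poly p w = 0" "fps_nth w 0 = \<zeta>" by (rule fps_hensel)
    then show ?thesis by (intro exI[of _ w]) (simp add: p_def)
  qed
  then obtain W where W: "\<And>\<zeta>. \<zeta> \<in> U \<Longrightarrow> poly G (W \<zeta>) = poly G 1 \<and> fps_nth (W \<zeta>) 0 = \<zeta>" by metis
  define h where "h = (\<lambda>\<zeta>. to_ac (fps_to_fls (W \<zeta>) / t))"
  have img: "\<Phi> ` fiber P = {w. poly (map_poly (\<lambda>c. ser (fps_const c)) P) w = to_ac \<xi>}"
    by (rule fiber_image[OF pl P])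
  have "h \<zeta> \<in> \<Phi> ` fiber P" if "\<zeta> \<in> U" for \<zeta>
  proof -
    interpret a: idom_hom "to_ac :: complex fls \<Rightarrow> _" by unfold_locales simp_all
    have "map_poly (\<lambda>c. ser (fps_const c)) P = map_poly to_ac (map_poly fls_const P)"
      by (simp add: poly_eq_iff coeff_map_poly ser_def)
    then have "poly (map_poly (\<lambda>c. ser (fps_const c)) P) (h \<zeta>) = to_ac (Q (fps_to_fls (W \<zeta>) / t))"
      unfolding h_def Q_def by (simp only: a.poly_map_poly)
    also have "\<dots> = to_ac \<xi>" using Q_iff[of "W \<zeta>"] W[OF that] by simp
    finally show ?thesis unfolding img by simp
  qed
  then have sub: "h ` U \<subseteq> \<Phi> ` fiber P" by blast
  have hX: "h \<zeta> * ser fps_X = ser (W \<zeta>)" for \<zeta>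
  proof -
    have "fps_to_fls (W \<zeta>) / t * t = fps_to_fls (W \<zeta>)"
      by (rule iffD1[OF nonzero_eq_divide_eq[OF t0] refl])
    then show ?thesis unfolding h_def ser_def t_def[symmetric] to_ac_mult[symmetric] by (simp only:)
  qed
  have injh: "inj_on h U"
  proof (rule inj_onI)
    fix \<zeta> \<zeta>' assume u: "\<zeta> \<in> U" "\<zeta>' \<in> U" "h \<zeta> = h \<zeta>'"
    have "ser (W \<zeta>) = ser (W \<zeta>')" by (simp only: hX[symmetric] u(3))
    then have "fps_nth (W \<zeta>) 0 = fps_nth (W \<zeta>') 0" by (simp only: ser_eq_iff)
    then show "\<zeta> = \<zeta>'" by (simp only: W[OF u(1), THEN conjunct2] W[OF u(2), THEN conjunct2])
  qed
  \<comment> \<open>The m roots of unity lift to m different solutions, which exhaust the fiber; so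
    every solution has a simple pole, and the leading coefficients are pairwise different.\<close>
  have "card (h ` U) = m" using card_image[OF injh] card_roots_unity_eq[OF m0(1)] by (simp add: U_def)
  moreover have "card (\<Phi> ` fiber P) \<le> m"
    using card_image_le[OF finite_fiber[OF P]] cardf by (simp add: m_def)
  ultimately have imgU: "h ` U = \<Phi> ` fiber P"
    using card_seteq[OF finite_imageI[OF finite_fiber[OF P]] sub] by simp
  show ?thesis
  proof (rule that[OF \<Phi>(1,2)])
    fix z assume "z \<in> fiber P"
    then obtain \<zeta> where "\<zeta> \<in> U" "\<Phi> z = h \<zeta>" using imgU by blast
    then show "\<exists>w. \<Phi> z * ser fps_X = ser w" using hX by auto
  next
    fix z z' w w' assume z: "z \<in> fiber P" "z' \<in> fiber P" "z \<noteq> z'" "\<Phi> z * ser fps_X = ser w" "\<Phi> z' * ser fps_X = ser w'"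
    obtain \<zeta> where \<zeta>: "\<zeta> \<in> U" "\<Phi> z = h \<zeta>" using imgU z(1) by blast
    obtain \<zeta>' where \<zeta>': "\<zeta>' \<in> U" "\<Phi> z' = h \<zeta>'" using imgU z(2) by blast
    have "w = W \<zeta>" using z(4) hX[of \<zeta>] \<zeta> by simp
    moreover have "w' = W \<zeta>'" using z(5) hX[of \<zeta>'] \<zeta>' by simp
    moreover have "\<zeta> \<noteq> \<zeta>'"
    proof
      assume "\<zeta> = \<zeta>'"
      then have "\<Phi> z = \<Phi> z'" by (simp only: \<zeta>(2) \<zeta>'(2))
      then show False using z(3) by simp
    qed
    ultimately show "fps_nth w 0 \<noteq> fps_nth w' 0" using W[OF \<zeta>(1)] W[OF \<zeta>'(1)] by simp
  qed
qed

text \<open>A nonempty product of differences would have a pole at infinity, but it is constant.\<close>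

lemma all_exchange:
  assumes P: "degree P > 0" "morse P"
  shows "card (fiber P) = degree P"
    and "y \<in> fiber P \<Longrightarrow> z \<in> fiber P \<Longrightarrow> y \<noteq> z \<Longrightarrow> exchange P y z"
proof -
  show cardf: "card (fiber P) = degree P" by (rule finite_place[OF P, of 0])
  obtain \<gamma> where \<gamma>: "rigid_disc P = fun_const \<gamma>" by (rule rigid_disc_const[OF P])
  obtain \<Phi> :: "algfun \<Rightarrow> complex fls alg_closure" where \<Phi>: "field_hom \<Phi>" "\<And>c. \<Phi> (fun_const c) = ser (fps_const c)"
    and int: "\<And>z. z \<in> fiber P \<Longrightarrow> \<exists>w. \<Phi> z * ser fps_X = ser w"
    and sep: "\<And>z z' w w'. z \<in> fiber P \<Longrightarrow> z' \<in> fiber P \<Longrightarrow> z \<noteq> z' \<Longrightarrow> \<Phi> z * ser fps_X = ser w \<Longrightarrow>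
      \<Phi> z' * ser fps_X = ser w' \<Longrightarrow> fps_nth w 0 \<noteq> fps_nth w' 0"
    using infinite_place[OF P(1) cardf] by blast
  interpret s: idom_hom ser by (rule ser_hom)
  obtain f where f: "\<Phi> (rigid_disc P) * ser fps_X ^ card (rigid_pairs P) = ser f" "fps_nth f 0 \<noteq> 0"
    by (rule place_rigid_disc[OF P(1) \<Phi>(1) int]) (use sep in blast)+
  have "ser (fps_const \<gamma> * fps_X ^ card (rigid_pairs P)) = ser f"
    using f(1) by (simp add: \<gamma> \<Phi>(2) s.hom_mult s.hom_power)
  then have "fps_const \<gamma> * fps_X ^ card (rigid_pairs P) = f" by (simp only: ser_eq_iff)
  \<comment> \<open>For a positive exponent the constant term of \<gamma> t^N would vanish, whereas
    \<open>f\<close> is a unit series.\<close>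
  then have "card (rigid_pairs P) = 0" using f(2) by (cases "card (rigid_pairs P)") auto
  then have "rigid_pairs P = {}" using finite_rigid_pairs[OF P(1)] by simp
  then show "y \<in> fiber P \<Longrightarrow> z \<in> fiber P \<Longrightarrow> y \<noteq> z \<Longrightarrow> exchange P y z"
    by (auto simp: rigid_pairs_def)
qed

section \<open>Radical towers\<close>

lemma base_aut_const: "base_aut \<sigma> \<Longrightarrow> \<sigma> (fun_const c) = fun_const c"
  by (simp add: base_aut_def fun_const_def)

text \<open>The quotient s/r is a root of y^n - 1, whose coefficients are complex; by
  \<open>poly_transcendental\<close> it is a constant.\<close>

lemma root_of_unity_const:
  fixes r s :: algfun
  assumes "n > 0" "r \<noteq> 0" "s ^ n = r ^ n"
  obtains \<zeta> where "s = fun_const \<zeta> * r"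
proof -
  interpret c: field_hom fun_const by (rule fun_const_hom)
  define q where "q = s / r"
  define p where "p = (Polynomial.monom 1 n - 1 :: complex poly)"
  have deg: "degree p = n" "p \<noteq> 0"
  proof -
    have "coeff p n = 1" using assms(1) by (simp add: p_def coeff_pCons one_pCons split: nat.splits)
    moreover have "degree p \<le> n" unfolding p_def by (rule degree_diff_le) (simp_all add: degree_monom_le)
    ultimately show "degree p = n" by (metis le_antisym le_degree zero_neq_one)
    then show "p \<noteq> 0" using assms(1) by auto
  qed
  have "q ^ n = 1" using assms by (simp add: q_def power_divide)
  moreover have "map_poly fun_const p = Polynomial.monom 1 n - 1"
    by (simp add: poly_eq_iff p_def c.hom_minus coeff_monom one_pCons coeff_pCons split: nat.splits)
  ultimately have "poly (map_poly fun_const p) q = 0" by (simp add: poly_monom)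
  have "q \<in> range fun_const"
  proof (rule ccontr)
    assume "q \<notin> range fun_const"
    then have "p = 0"
      by (rule poly_transcendental[OF fun_const_hom]) (rule \<open>poly (map_poly fun_const p) q = 0\<close>)
    then show False using deg by simp
  qed
  then obtain \<zeta> where "q = fun_const \<zeta>" by blast
  then have "s = fun_const \<zeta> * r" using assms(2) by (simp add: q_def field_simps)
  then show ?thesis by (rule that)
qed

text \<open>Both automorphisms multiply \<open>r\<close> by a constant root of unity, so their commutator
  fixes \<open>r\<close>.\<close>

lemma commutator_fixes_radical:
  fixes r :: algfun
  assumes s: "base_aut \<sigma>" and t: "base_aut \<tau>" and n: "n > 0"
    and fixed: "\<sigma> (r ^ n) = r ^ n" "\<tau> (r ^ n) = r ^ n"
  shows "\<sigma> (\<tau> r) = \<tau> (\<sigma> r)"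
proof (cases "r = 0")
  case True
  interpret s: field_hom \<sigma> using s by (simp add: base_aut_def)
  interpret t: field_hom \<tau> using t by (simp add: base_aut_def)
  show ?thesis by (simp add: True)
next
  case False
  interpret s: field_hom \<sigma> using s by (simp add: base_aut_def)
  interpret t: field_hom \<tau> using t by (simp add: base_aut_def)
  obtain \<zeta> where z: "\<sigma> r = fun_const \<zeta> * r"
    using root_of_unity_const[OF n False, of "\<sigma> r"] fixed(1) by (metis s.hom_power)
  obtain \<zeta>' where z': "\<tau> r = fun_const \<zeta>' * r"
    using root_of_unity_const[OF n False, of "\<tau> r"] fixed(2) by (metis t.hom_power)
  show ?thesis
    by (simp add: z z' s.hom_mult t.hom_mult base_aut_const[OF s] base_aut_const[OF t])
qed

text \<open>The fixed elements of \<sigma> form a field, so fixing generators suffices. The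
  preliminary facts translate the operations of \<open>ring_of_type_algebra\<close> into those of
  the type class.\<close>

lemma fixed_generate_field:
  assumes s: "base_aut \<sigma>" and "\<And>u. u \<in> H \<Longrightarrow> \<sigma> u = u"
    and "x \<in> generate_field ring_of_type_algebra H"
  shows "\<sigma> x = (x :: algfun)"
proof -
  interpret s: field_hom \<sigma> using s by (simp add: base_aut_def)
  interpret R: field "ring_of_type_algebra :: algfun ring" by rule
  have add: "x \<oplus>\<^bsub>ring_of_type_algebra\<^esub> y = x + y" and mult: "x \<otimes>\<^bsub>ring_of_type_algebra\<^esub> y = x * y"
    and zero: "\<zero>\<^bsub>ring_of_type_algebra\<^esub> = (0::algfun)" and one: "\<one>\<^bsub>ring_of_type_algebra\<^esub> = (1::algfun)"
    and carr: "x \<in> carrier ring_of_type_algebra"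
    for x y :: algfun
    by (simp_all add: ring_of_type_algebra_def)
  have minus: "\<ominus>\<^bsub>ring_of_type_algebra\<^esub> x = - x" for x :: algfun
    by (rule R.minus_equality) (simp_all add: add zero carr)
  have inv: "inv\<^bsub>ring_of_type_algebra\<^esub> x = inverse x" if "x \<noteq> 0" for x :: algfun
    by (rule R.comm_inv_char) (use that in \<open>simp_all add: mult one carr\<close>)
  show ?thesis
    using assms(3)
  proof induction
    case (m_inv h)
    have "\<sigma> (inverse h) = inverse h" using m_inv.IH by (simp add: s.hom_inverse)
    then show ?case using m_inv.hyps by (simp add: zero inv)
  qed (simp_all add: assms(2) add mult one minus s.hom_add s.hom_mult s.hom_uminus)
qed

section \<open>Commutators of 3-cycles along a tower\<close>

definition acts_cycle :: "complex poly \<Rightarrow> (algfun \<Rightarrow> algfun) \<Rightarrow> algfun \<Rightarrow> algfun \<Rightarrow> algfun \<Rightarrow> bool" where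
  "acts_cycle P \<sigma> a b c \<longleftrightarrow> \<sigma> a = b \<and> \<sigma> b = c \<and> \<sigma> c = a \<and> (\<forall>u\<in>fiber P - {a, b, c}. \<sigma> u = u)"

text \<open>Two 3-cycles meeting in exactly one point \<open>a\<close> have a 3-cycle as commutator;
  it runs through \<open>a\<close> and its images under the two cycles. Their supports together
  occupy five points, whence the bound on m.\<close>

lemma cycle_commutator:
  assumes s: "base_aut \<sigma>" "acts_cycle P \<sigma> a d e" and t: "base_aut \<tau>" "acts_cycle P \<tau> a b c"
    and dist: "distinct [a, b, c, d, e]" and fib: "{a, b, c, d, e} \<subseteq> fiber P"
  defines "\<rho> \<equiv> \<lambda>x. \<sigma> (\<tau> (inv_into UNIV \<sigma> (inv_into UNIV \<tau> x)))"
  shows "acts_cycle P \<rho> a d b"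
proof -
  have iis: "inv_into UNIV \<sigma> y = x" if "\<sigma> x = y" for x y
    using base_aut_bij[OF s(1)] that by (metis bij_is_inj inv_f_f)
  have iit: "inv_into UNIV \<tau> y = x" if "\<tau> x = y" for x y
    using base_aut_bij[OF t(1)] that by (metis bij_is_inj inv_f_f)
  have sv: "\<sigma> a = d" "\<sigma> d = e" "\<sigma> e = a" "\<sigma> b = b" "\<sigma> c = c"
    "\<And>u. u \<in> fiber P \<Longrightarrow> u \<notin> {a, b, c, d, e} \<Longrightarrow> \<sigma> u = u"
    using s(2) dist fib by (auto simp: acts_cycle_def)
  have tv: "\<tau> a = b" "\<tau> b = c" "\<tau> c = a" "\<tau> d = d" "\<tau> e = e"
    "\<And>u. u \<in> fiber P \<Longrightarrow> u \<notin> {a, b, c, d, e} \<Longrightarrow> \<tau> u = u"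
    using t(2) dist fib by (auto simp: acts_cycle_def)
  have isv: "inv_into UNIV \<sigma> d = a" "inv_into UNIV \<sigma> e = d" "inv_into UNIV \<sigma> a = e"
    "inv_into UNIV \<sigma> b = b" "inv_into UNIV \<sigma> c = c"
    "\<And>u. u \<in> fiber P \<Longrightarrow> u \<notin> {a, b, c, d, e} \<Longrightarrow> inv_into UNIV \<sigma> u = u"
    by (intro iis; simp add: sv)+
  have itv: "inv_into UNIV \<tau> b = a" "inv_into UNIV \<tau> c = b" "inv_into UNIV \<tau> a = c"
    "inv_into UNIV \<tau> d = d" "inv_into UNIV \<tau> e = e"
    "\<And>u. u \<in> fiber P \<Longrightarrow> u \<notin> {a, b, c, d, e} \<Longrightarrow> inv_into UNIV \<tau> u = u"
    by (intro iit; simp add: tv)+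
  have "\<rho> a = d" "\<rho> b = a" "\<rho> c = c" "\<rho> d = b" "\<rho> e = e"
    by (simp_all add: \<rho>_def isv(1-5) itv(1-5) sv(1-5) tv(1-5))
  moreover have "\<rho> u = u" if "u \<in> fiber P" "u \<notin> {a, b, c, d, e}" for u
    unfolding \<rho>_def itv(6)[OF that] isv(6)[OF that] tv(6)[OF that] by (rule sv(6)[OF that])
  ultimately show ?thesis unfolding acts_cycle_def by auto
qed

text \<open>The claim is for all 3-cycles at once, because each step up writes a given cycle as a
  commutator of two others. At the bottom a 3-cycle is a product of two transpositions.\<close>

lemma tower_cycles:
  assumes P: "card (fiber P) \<ge> 5"
    and exch: "\<And>y z. y \<in> fiber P \<Longrightarrow> z \<in> fiber P \<Longrightarrow> y \<noteq> z \<Longrightarrow> exchange P y z"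
    and K: "radical_tower K s"
  shows "i \<le> s \<Longrightarrow> x \<in> fiber P \<Longrightarrow> y \<in> fiber P \<Longrightarrow> z \<in> fiber P \<Longrightarrow> distinct [x, y, z] \<Longrightarrow>
    \<exists>\<sigma>. base_aut \<sigma> \<and> (\<forall>u\<in>K i. \<sigma> u = u) \<and> acts_cycle P \<sigma> x y z"
proof (induction i arbitrary: x y z)
  case 0
  obtain \<sigma> where s: "base_aut \<sigma>" "\<sigma> x = y" "\<sigma> y = x" "\<And>u. u \<in> fiber P - {x, y} \<Longrightarrow> \<sigma> u = u"
    using exch[of x y] 0 by (auto simp: exchange_def)
  obtain \<tau> where t: "base_aut \<tau>" "\<tau> y = z" "\<tau> z = y" "\<And>u. u \<in> fiber P - {y, z} \<Longrightarrow> \<tau> u = u"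
    using exch[of y z] 0 by (auto simp: exchange_def)
  have st: "base_aut (\<lambda>u. \<sigma> (\<tau> u))"
    by (rule base_aut_comp[OF s(1) t(1)])
  have "\<sigma> z = z" by (rule s(4)) (use 0 in auto)
  have "\<tau> x = x" by (rule t(4)) (use 0 in auto)
  have "acts_cycle P (\<lambda>u. \<sigma> (\<tau> u)) x y z"
    unfolding acts_cycle_def using s(2,3) \<open>\<sigma> z = z\<close> t(2,3) \<open>\<tau> x = x\<close> 0 by (simp add: s(4) t(4))
  moreover have "\<forall>u\<in>K 0. \<sigma> (\<tau> u) = u"
    using st K by (auto simp: radical_tower_def base_aut_def)
  ultimately show ?case using st by (intro exI[of _ "\<lambda>u. \<sigma> (\<tau> u)"]) simp
next
  case (Suc i)
  have "finite (fiber P)" using P card.infinite by fastforce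
  then have "card (fiber P - {x, y, z}) \<ge> 2"
    using P Suc.prems by (subst card_Diff_subset) auto
  then obtain T where "T \<subseteq> fiber P - {x, y, z}" "card T = 2"
    by (rule obtain_subset_with_card_n)
  then obtain c e where ce: "c \<in> fiber P" "e \<in> fiber P" "c \<noteq> e" "c \<notin> {x, y, z}" "e \<notin> {x, y, z}"
    by (auto simp: card_2_iff)
  \<comment> \<open>The required cycle (x y z) is the commutator of (x y e) and (x z c), so x, z, c,
    y, e take the roles of a, b, c, d, e in \<open>cycle_commutator\<close>.\<close>
  have dist: "distinct [x, z, c, y, e]" "distinct [x, y, e]" "distinct [x, z, c]" using ce Suc.prems by auto
  obtain \<sigma> where s: "base_aut \<sigma>" "\<forall>u\<in>K i. \<sigma> u = u" "acts_cycle P \<sigma> x y e"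
    using Suc.IH[of x y e] Suc.prems ce dist(2) by auto
  obtain \<tau> where t: "base_aut \<tau>" "\<forall>u\<in>K i. \<tau> u = u" "acts_cycle P \<tau> x z c"
    using Suc.IH[of x z c] Suc.prems ce dist(3) by auto
  define \<rho> where "\<rho> = (\<lambda>u. \<sigma> (\<tau> (inv_into UNIV \<sigma> (inv_into UNIV \<tau> u))))"
  note iis = base_aut_inv[OF s(1)] and iit = base_aut_inv[OF t(1)]
  have \<rho>: "base_aut \<rho>" unfolding \<rho>_def
    by (rule base_aut_comp[OF s(1) base_aut_comp[OF t(1) base_aut_comp[OF iis iit]]])
  have invs: "inv_into UNIV \<sigma> (\<sigma> u) = u" "\<sigma> (inv_into UNIV \<sigma> u) = u"
    "inv_into UNIV \<tau> (\<tau> u) = u" "\<tau> (inv_into UNIV \<tau> u) = u" for u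
    using base_aut_bij[OF s(1)] base_aut_bij[OF t(1)]
    by (simp_all add: bij_is_inj bij_is_surj surj_f_inv_f)
  have fixi: "inv_into UNIV \<sigma> u = u" "inv_into UNIV \<tau> u = u" if "u \<in> K i" for u
    using invs(1)[of u] invs(3)[of u] s(2) t(2) that by simp_all
  have "i < s" using Suc.prems(1) by simp
  then have "\<exists>r n. n > 0 \<and> r ^ n \<in> K i \<and> K (Suc i) = generate_field ring_of_type_algebra (insert r (K i))"
    using K by (simp add: radical_tower_def)
  then obtain r n where r: "n > 0" "r ^ n \<in> K i"
    "K (Suc i) = generate_field ring_of_type_algebra (insert r (K i))"
    by (elim exE conjE)
  have "\<rho> r = r"
  proof -
    \<comment> \<open>It is the inverses that are commuted on \<open>r\<close>; applying \<tau> and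
      then \<sigma> afterwards cancels everything.\<close>
    have "inv_into UNIV \<sigma> (inv_into UNIV \<tau> r) = inv_into UNIV \<tau> (inv_into UNIV \<sigma> r)"
      by (rule commutator_fixes_radical[OF iis iit r(1)]) (simp_all add: fixi r(2))
    then show ?thesis by (simp add: \<rho>_def invs)
  qed
  moreover have "\<rho> u = u" if "u \<in> K i" for u
    using that s(2) t(2) by (simp add: \<rho>_def fixi)
  ultimately have "\<rho> u = u" if "u \<in> K (Suc i)" for u
    using fixed_generate_field[OF \<rho>, of "insert r (K i)" u] that r(3) by auto
  moreover have "acts_cycle P \<rho> x y z"
    unfolding \<rho>_def by (rule cycle_commutator[OF s(1,3) t(1,3) dist(1)]) (use ce Suc.prems in auto)
  ultimately show ?case using \<rho> by (intro exI[of _ \<rho>]) simp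
qed

lemma not_expressed_by_radicals:
  assumes P: "card (fiber P) \<ge> 5"
    and exch: "\<And>y z. y \<in> fiber P \<Longrightarrow> z \<in> fiber P \<Longrightarrow> y \<noteq> z \<Longrightarrow> exchange P y z"
    and y: "y \<in> fiber P"
  shows "\<not> expressed_by_radicals y"
proof
  assume "expressed_by_radicals y"
  then obtain K s where K: "radical_tower K s" "y \<in> K s" by (auto simp: expressed_by_radicals_def)
  have "finite (fiber P)" using P card.infinite by fastforce
  then have "card (fiber P - {y}) \<ge> 2" using P y by (subst card_Diff_subset) auto
  then obtain T where "T \<subseteq> fiber P - {y}" "card T = 2"
    by (rule obtain_subset_with_card_n)
  then obtain u v where uv: "u \<in> fiber P" "v \<in> fiber P" "u \<noteq> v" "u \<noteq> y" "v \<noteq> y"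
    by (auto simp: card_2_iff)
  then obtain \<sigma> where "\<forall>w\<in>K s. \<sigma> w = w" "acts_cycle P \<sigma> y u v"
    using tower_cycles[OF P exch K(1) order.refl y uv(1,2)] by auto
  then show False using K(2) uv(4) by (auto simp: acts_cycle_def)
qed

theorem corollary3p2:
  fixes m :: nat and a :: "complex vec" and y :: algfun
  assumes "m \<ge> 5"
    and "a \<in> carrier_vec m"
    and "CVD a \<noteq> 0"
    and "poly (map_poly fun_const (P_poly a)) y = fun_x"
  shows "\<not> expressed_by_radicals y"
proof -
  have m: "dim_vec a = m" using assms(2) by simp
  have P: "degree (P_poly a) = m" by (simp add: degree_P_poly m)
  have "dim_vec a \<ge> 3" using m assms(1) by simp
  note critical = CVD_nonzero_critical[OF this assms(3)]
  have pos: "degree (P_poly a) > 0" using P assms(1) by simp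
  have morse: "morse (P_poly a)"
    unfolding morse_def by (intro conjI allI impI) (erule critical(1), erule critical(2), assumption+)
  have "card (fiber (P_poly a)) \<ge> 5" using all_exchange(1)[OF pos morse] P assms(1) by simp
  moreover have "y \<in> fiber (P_poly a)" using assms(4) by (simp add: fiber_def)
  ultimately show ?thesis using all_exchange(2)[OF pos morse] by (intro not_expressed_by_radicals)
qed

end
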